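(* As $n\to\infty$, $$\sup_{f\in H^n}\frac{|f|_{\mathcal{C}}}{|f|_{\mathcal{U}}}\in\Omega(2^n).$$
   Context: Let $\mathcal{B}=\{0,1\}$, let $\mathcal{B}^*$ be the set of finite binary strings and $|h|$ the length of $h\in\mathcal{B}^*$. For $n\in\mathbb{N}^+$, $H^n$ is the set of all functions $\mathcal{B}^n\to\mathcal{B}$. An interpreter is a Turing machine computing a partial function $\varphi:\mathcal{B}^*\times\mathcal{B}^*\to\mathcal{B}\cup\{\bot\}$, where $\bot$ denotes non-halting (or invalid) output. For $f\in H^n$, $|f|_\varphi=\min\{|h|:\varphi(h,x)=f(x)\ \forall x\in\mathcal{B}^n\}$ ($+\infty$ if no such $h$). Turing machines have alphabet $\{0,1,b\}$ ($b$ blank), a finite state set containing an initial state and two final states accept/reject; the output is $1$ if halting in accept, $0$ if halting in reject, $\bot$ otherwise; multi-tape machines have read-only input tapes and read/write work tapes, and the transition function is a finite list of rules. $E(T)$ is a fixed prefix-free binary encoding of a machine $T$ listing its rules. $\mathcal{U}$ is the universal interpreter: on $(p,x)$, if $p=E(T)u$ (concatenation) for a two-input-tape Turing machine $T$ (with a fixed number of work tapes) and $u\in\mathcal{B}^*$, it outputs $T(u,x)$; otherwise $\bot$. A Boolean circuit on $n$ inputs is a DAG with a unique sink (output) whose sources are labelled by input indices in $\{1,\dots,n\}$ and whose other vertices (gates) are labelled AND, OR (two incoming edges) or NOT (one incoming edge); its size $|C|$ is its number of vertices. The circuit interpreter $\mathcal{C}$ reads a program $h=0^{\lceil\log_2 n\rceil}1\,[\text{binary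 expansion of } n]\,0^{|C|}1\,[\text{description of vertex } i]_{i=1}^{|C|}$, each vertex being described by its label and its parents/input index using $\max\{2\lceil\log_2|C|\rceil,\lceil\log_2 n\rceil\}$ bits beyond the label bits, so a circuit $C$ on $n$ inputs has encoding length $L(|C|,n)=2\lceil\log_2 n\rceil+2+|C|(3+\max\{2\lceil\log_2|C|\rceil,\lceil\log_2 n\rceil\})$; $\mathcal{C}(h,x)$ is the circuit's output on $x\in\mathcal{B}^n$, and $\bot$ if $h$ is malformed. Hence $|f|_{\mathcal{C}}=\min\{L(|C|,n): C \text{ computes } f\}$. *)

theory Defs
  imports Complex_Main "HOL-Library.Extended_Real" "HOL-Library.Landau_Symbols"
    "HOL-Library.Sublist"
begin

text \<open>Binary strings are bool lists. H n: functions on strings of length n,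
  represented canonically (value False outside length n).\<close>
definition H :: "nat \<Rightarrow> (bool list \<Rightarrow> bool) set" where
  "H n = {f. \<forall>x. length x \<noteq> n \<longrightarrow> f x = False}"

type_synonym interpreter = "bool list \<Rightarrow> bool list \<Rightarrow> bool option"

definition size_wrt :: "interpreter \<Rightarrow> nat \<Rightarrow> (bool list \<Rightarrow> bool) \<Rightarrow> enat" where
  "size_wrt \<phi> n f =
     (INF h \<in> {h. \<forall>x. length x = n \<longrightarrow> \<phi> h x = Some (f x)}. enat (length h))"

datatype sym = S0 | S1 | Bl
datatype move = MvL | MvR | MvS

text \<open>A rule (q, reads, q', writes, moves): in state q reading the symbols
  reads (tape 0, tape 1 = input tapes, tapes 2..k+1 = work tapes), go to q',
  write writes on the k work tapes and move the k+2 heads.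
  States are naturals: 0 initial, 1 accept, 2 reject.\<close>
type_synonym rule = "nat \<times> sym list \<times> nat \<times> sym list \<times> move list"
type_synonym tm = "rule list"

definition wf_tm :: "nat \<Rightarrow> tm \<Rightarrow> bool" where
  "wf_tm k T \<longleftrightarrow> (\<forall>(q, rd, q', wr, mvs) \<in> set T.
      length rd = k + 2 \<and> length wr = k \<and> length mvs = k + 2)"

type_synonym conf = "nat \<times> int list \<times> (int \<Rightarrow> sym) list"

definition input_sym :: "bool list \<Rightarrow> int \<Rightarrow> sym" where
  "input_sym u i = (if 0 \<le> i \<and> i < int (length u) then (if u ! nat i then S1 else S0) else Bl)"

definition read_syms :: "nat \<Rightarrow> bool list \<Rightarrow> bool list \<Rightarrow> conf \<Rightarrow> sym list" where
  "read_syms k u x c = (case c of (q, hs, ws) \<Rightarrow>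
     map (\<lambda>j. if j = 0 then input_sym u (hs ! 0)
              else if j = 1 then input_sym x (hs ! 1)
              else (ws ! (j - 2)) (hs ! j)) [0..<k+2])"

fun delta :: "move \<Rightarrow> int" where
  "delta MvL = -1" | "delta MvR = 1" | "delta MvS = 0"

text \<open>One step; final states and configurations with no applicable rule are
  fixed points (a stuck machine never reaches a final state: output bottom).
  The first matching rule in the list is applied.\<close>
definition tm_step :: "nat \<Rightarrow> tm \<Rightarrow> bool list \<Rightarrow> bool list \<Rightarrow> conf \<Rightarrow> conf" where
  "tm_step k T u x c = (case c of (q, hs, ws) \<Rightarrow>
     if q = 1 \<or> q = 2 then c else
     (case find (\<lambda>r. fst r = q \<and> fst (snd r) = read_syms k u x c) T of
        None \<Rightarrow> c
      | Some (_, _, q', wr, mvs) \<Rightarrow>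
          (q', map2 (\<lambda>h m. h + delta m) hs mvs,
           map (\<lambda>j. (ws ! j)((hs ! (j + 2)) := wr ! j)) [0..<k])))"

definition tm_init :: "nat \<Rightarrow> conf" where
  "tm_init k = (0, replicate (k + 2) 0, replicate k (\<lambda>_. Bl))"

definition tm_run :: "nat \<Rightarrow> tm \<Rightarrow> bool list \<Rightarrow> bool list \<Rightarrow> bool option" where
  "tm_run k T u x =
     (if \<exists>t. fst ((tm_step k T u x ^^ t) (tm_init k)) = 1 then Some True
      else if \<exists>t. fst ((tm_step k T u x ^^ t) (tm_init k)) = 2 then Some False
      else None)"

definition prefix_free_on :: "(tm \<Rightarrow> bool list) \<Rightarrow> tm set \<Rightarrow> bool" where
  "prefix_free_on E A \<longleftrightarrow> (\<forall>T1\<in>A. \<forall>T2\<in>A. T1 \<noteq> T2 \<longrightarrow> \<not> prefix (E T1) (E T2))"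

definition U :: "nat \<Rightarrow> (tm \<Rightarrow> bool list) \<Rightarrow> interpreter" where
  "U k E p x =
     (if \<exists>T u. wf_tm k T \<and> p = E T @ u
      then (case THE Tu. wf_tm k (fst Tu) \<and> p = E (fst Tu) @ snd Tu of
              (T, u) \<Rightarrow> tm_run k T u x)
      else None)"

text \<open>A circuit is a list of vertices in topological order; parents are indices
  of earlier vertices; the last vertex is the output (sink).  Inputs are
  labelled 1..n.\<close>
datatype gate = Inp nat | AndG nat nat | OrG nat nat | NotG nat

fun parents :: "gate \<Rightarrow> nat set" where
  "parents (Inp _) = {}" | "parents (AndG a b) = {a, b}"
| "parents (OrG a b) = {a, b}" | "parents (NotG a) = {a}"

definition wf_circuit :: "nat \<Rightarrow> gate list \<Rightarrow> bool" where
  "wf_circuit n C \<longleftrightarrow> C \<noteq> [] \<and>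
     (\<forall>i < length C. case C ! i of
         Inp j \<Rightarrow> 1 \<le> j \<and> j \<le> n
       | AndG a b \<Rightarrow> a < i \<and> b < i \<and> a \<noteq> b
       | OrG a b \<Rightarrow> a < i \<and> b < i \<and> a \<noteq> b
       | NotG a \<Rightarrow> a < i) \<and>
     (\<forall>i < length C - 1. \<exists>j < length C. i \<in> parents (C ! j))"

fun gate_val :: "bool list \<Rightarrow> bool list \<Rightarrow> gate \<Rightarrow> bool" where
  "gate_val x vs (Inp j) = x ! (j - 1)"
| "gate_val x vs (AndG a b) = (vs ! a \<and> vs ! b)"
| "gate_val x vs (OrG a b) = (vs ! a \<or> vs ! b)"
| "gate_val x vs (NotG a) = (\<not> vs ! a)"

definition circ_vals :: "gate list \<Rightarrow> bool list \<Rightarrow> bool list" where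
  "circ_vals C x = fold (\<lambda>g vs. vs @ [gate_val x vs g]) C []"

definition circ_eval :: "gate list \<Rightarrow> bool list \<Rightarrow> bool" where
  "circ_eval C x = last (circ_vals C x)"

definition clog :: "nat \<Rightarrow> nat" where
  "clog m = nat \<lceil>log 2 (real m)\<rceil>"

text \<open>Encoding length L(|C|, n).\<close>
definition L :: "nat \<Rightarrow> nat \<Rightarrow> nat" where
  "L s n = 2 * clog n + 2 + s * (3 + max (2 * clog s) (clog n))"

definition circ_size :: "nat \<Rightarrow> (bool list \<Rightarrow> bool) \<Rightarrow> enat" where
  "circ_size n f =
     (INF C \<in> {C. wf_circuit n C \<and> (\<forall>x. length x = n \<longrightarrow> circ_eval C x = f x)}.
        enat (L (length C) n))"

end

theory Submission
  imports Defs
begin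

text \<open>
  A single Turing machine computes, for every n, a function whose smallest circuit has about
  2^n / n vertices. Such a function has constant size for the universal interpreter, while a circuit
  with s vertices costs about 2 s log s bits, that is, a constant times 2^n.

  The function comes from diagonalization. A circuit with s vertices can be replayed by 3 s NAND
  operations whose operands are addressed with n + 1 bits each, so all circuits with
  6 (n + 1) s < 2^n are covered by the codes c < 2^(2^n - 1). Fewer than 2^(2^n) truth tables
  arise from these codes; the least number that is not one of them is the truth table of the hard
  function. It is defined by nested bounded loops on natural numbers, which are executed by
  counters kept in unary on one work tape.

  The supremum must be finite, since \<^const>\<open>real_of_ereal\<close> maps infinity to 0. This is why circuits
  are constructed for all functions, and why prefix-freeness is needed to exclude empty programs.
\<close>

section \<open>Structured programs for one work tape\<close>


text \<open>The factor lost by counting is regained from the encoding length. Three NANDs per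
  vertex, two addresses per NAND and n + 1 bits per address make 6 (n + 1) bits of code, so counting
  alone yields only s >= 2^n / (6 (n + 1)). For n >= 14 such an s satisfies
  \<open>n div 2 \<le> clog s\<close>; each vertex then contributes at least n + 1 bits to
  \<open>L\<close>, which cancels the denominator and leaves \<open>2 ^ n \<le> 6 * L s n\<close>.
  The obstacle is that one explicit machine has to serve all lengths, in a model that offers nothing
  but rule lists. Its running time is irrelevant, so exhaustive search and unary counters are
  affordable, and of a program one only has to show that it ends with the right tape contents. The
  encoding \<open>E\<close> is arbitrary apart from being prefix-free; the length e of the code of
  this one machine enters the final constant 1 / (6 e).\<close>

datatype com =
    Act "sym \<Rightarrow> sym \<Rightarrow> sym \<times> move \<times> move"
  | While "sym \<Rightarrow> sym \<Rightarrow> bool" "com list"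
  | Branch "sym \<Rightarrow> sym \<Rightarrow> bool" "com list" "com list"

type_synonym store = "int \<times> int \<times> (int \<Rightarrow> sym)"

text \<open>The list of commands that remain to be executed is the state of the machine; only finitely many
  lists are reachable from a given program (see \<open>conts\<close>). Programs see the second input tape and the
  first work tape.\<close>

fun trans :: "com list \<Rightarrow> sym \<Rightarrow> sym \<Rightarrow> com list \<times> sym \<times> move \<times> move" where
  "trans [] a b = ([], b, MvS, MvS)"
| "trans (Act f # K) a b = (K, f a b)"
| "trans (While t cs # K) a b = (if t a b then cs @ While t cs # K else K, b, MvS, MvS)"
| "trans (Branch t cs ds # K) a b = ((if t a b then cs else ds) @ K, b, MvS, MvS)"

definition mstep :: "bool list \<Rightarrow> com list \<times> store \<Rightarrow> com list \<times> store" where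
  "mstep x = (\<lambda>(cs, i, j, w). case trans cs (input_sym x i) (w j) of
     (cs', b, m1, m2) \<Rightarrow> (cs', i + delta m1, j + delta m2, w(j := b)))"

lemma mstep_Nil: "mstep x ([], s) = ([], s)"
  by (cases s) (simp add: mstep_def)

text \<open>The continuation \<open>K\<close> is arbitrary, so that executions of blocks can be
  concatenated and reused inside loop bodies. The number of steps is hidden, since only termination
  matters.\<close>

definition exec :: "bool list \<Rightarrow> com list \<Rightarrow> store \<Rightarrow> store \<Rightarrow> bool" where
  "exec x cs s s' \<longleftrightarrow> (\<forall>K. \<exists>t. (mstep x ^^ t) (cs @ K, s) = (K, s'))"

lemma exec_Nil: "exec x [] s s"
  unfolding exec_def by (auto intro: exI[of _ 0])

lemma exec_append:
  assumes "exec x cs s s'" "exec x ds s' s''"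
  shows "exec x (cs @ ds) s s''"
  unfolding exec_def
proof
  fix K
  obtain t1 where "(mstep x ^^ t1) (cs @ ds @ K, s) = (ds @ K, s')"
    using spec[OF assms(1)[unfolded exec_def], of "ds @ K"] by auto
  moreover obtain t2 where "(mstep x ^^ t2) (ds @ K, s') = (K, s'')"
    using spec[OF assms(2)[unfolded exec_def], of K] by auto
  ultimately have "(mstep x ^^ (t2 + t1)) ((cs @ ds) @ K, s) = (K, s'')"
    by (simp add: funpow_add)
  then show "\<exists>t. (mstep x ^^ t) ((cs @ ds) @ K, s) = (K, s'')" by blast
qed

lemma exec_Cons: "exec x [c] s s' \<Longrightarrow> exec x cs s' s'' \<Longrightarrow> exec x (c # cs) s s''"
  using exec_append[of x "[c]" s s' cs s''] by simp

lemma exec_by_mstep: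
  assumes "\<And>K. mstep x (cs @ K, s) = (ds @ K, s')" "exec x ds s' s''"
  shows "exec x cs s s''"
  unfolding exec_def
proof
  fix K
  obtain t where "(mstep x ^^ t) (ds @ K, s') = (K, s'')"
    using spec[OF assms(2)[unfolded exec_def], of K] by auto
  then have "(mstep x ^^ Suc t) (cs @ K, s) = (K, s'')"
    by (simp add: funpow_Suc_right assms(1) del: funpow.simps)
  then show "\<exists>t. (mstep x ^^ t) (cs @ K, s) = (K, s'')" by blast
qed

lemma exec_Act:
  assumes "f (input_sym x i) (w j) = (b, m1, m2)"
  shows "exec x [Act f] (i, j, w) (i + delta m1, j + delta m2, w(j := b))"
  by (rule exec_by_mstep[OF _ exec_Nil]) (simp add: mstep_def assms)

lemma exec_While_stop:
  assumes "\<not> t (input_sym x i) (w j)"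
  shows "exec x [While t cs] (i, j, w) (i, j, w)"
  by (rule exec_by_mstep[OF _ exec_Nil]) (simp add: mstep_def assms)

lemma exec_While_step:
  assumes "t (input_sym x i) (w j)" "exec x cs (i, j, w) s'" "exec x [While t cs] s' s''"
  shows "exec x [While t cs] (i, j, w) s''"
  by (rule exec_by_mstep[OF _ exec_append[OF assms(2,3)]]) (simp add: mstep_def assms)

lemma exec_Branch:
  assumes "exec x (if t (input_sym x i) (w j) then cs else ds) (i, j, w) s'"
  shows "exec x [Branch t cs ds] (i, j, w) s'"
  by (rule exec_by_mstep[OF _ assms]) (simp add: mstep_def)

text \<open>An upper bound on the lists reachable from a program. What remains of a loop body is
  always followed by the loop itself, so iterating adds no new lists. The loop list is not inserted
  explicitly because it arises from the exhausted body \<open>ds = []\<close>.\<close>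

fun conts :: "com list \<Rightarrow> com list set" where
  "conts [] = {[]}"
| "conts (Act f # K) = insert (Act f # K) (conts K)"
| "conts (While t cs # K) = conts K \<union> (\<lambda>ds. ds @ While t cs # K) ` conts cs"
| "conts (Branch t cs ds # K) = insert (Branch t cs ds # K)
     (conts K \<union> (\<lambda>ds. ds @ K) ` (conts cs \<union> conts ds))"

lemma finite_conts: "finite (conts cs)"
  by (induction cs rule: conts.induct) auto

lemma Nil_in_conts: "[] \<in> conts cs"
  by (induction cs rule: conts.induct) auto

lemma self_in_conts: "cs \<in> conts cs"
  using Nil_in_conts by (induction cs rule: conts.induct) (auto intro: image_eqI)

lemma trans_append: "cs \<noteq> [] \<Longrightarrow> fst (trans (cs @ K) a b) = fst (trans cs a b) @ K"
  by (cases "(cs, a, b)" rule: trans.cases) auto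

text \<open>A leftover \<open>es\<close> of a body either still has a command, and the tail behind
  it is merely carried along (\<open>trans_append\<close>), or it is exhausted and the tail takes
  over. The second case is where the tail has to be an element of its own
  \<open>conts\<close>.\<close>

lemma trans_in_conts: "ds \<in> conts cs \<Longrightarrow> fst (trans ds a b) \<in> conts cs"
proof (induction cs arbitrary: ds rule: conts.induct)
  case 1
  then show ?case by simp
next
  case (2 f K)
  then show ?case by (auto simp: self_in_conts)
next
  case (3 t cs K)
  show ?case
  proof (cases "ds \<in> conts K")
    case True
    then show ?thesis using 3 by simp
  next
    case False
    then obtain es where es: "es \<in> conts cs" "ds = es @ While t cs # K"
      using "3.prems" by auto
    then show ?thesis
      using "3.IH"(2)[OF es(1)] self_in_conts[of K] self_in_conts[of cs]
      by (cases "es = []") (auto simp: trans_append)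
  qed
next
  case (4 t cs ds' K)
  consider "ds = Branch t cs ds' # K" | "ds \<in> conts K"
    | es where "es \<in> conts cs" "ds = es @ K" | es where "es \<in> conts ds'" "ds = es @ K"
    using "4.prems" by auto
  then show ?case
  proof cases
    case 1
    then show ?thesis using self_in_conts[of cs] self_in_conts[of ds'] by auto
  next
    case 2
    then show ?thesis using 4 by simp
  next
    case 3
    then show ?thesis using "4.IH"(2)[OF 3(1)] "4.IH"(1) self_in_conts[of K]
      by (cases "es = []") (auto simp: trans_append)
  next
    case 4: 4
    then show ?thesis using "4.IH"(3)[OF 4(1)] "4.IH"(1) self_in_conts[of K]
      by (cases "es = []") (auto simp: trans_append)
  qed
qed

text \<open>The first input tape will hold the empty string, so its head rests on cell 0 and reads a
  blank. The k - 1 surplus work tapes stay blank with resting heads.\<close>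

definition embed :: "nat \<Rightarrow> (com list \<Rightarrow> nat) \<Rightarrow> com list \<times> store \<Rightarrow> conf" where
  "embed k enc = (\<lambda>(cs, i, j, w).
     (enc cs, 0 # i # j # replicate (k - 1) 0, w # replicate (k - 1) (\<lambda>_. Bl)))"

text \<open>The exhausted program is a state of its own, from which one last step accepts or rejects
  according to the scanned cell of the first work tape, \<open>rd ! 2\<close>. Surplus work tapes
  get back what was read (\<open>drop 3 rd\<close>).\<close>

definition rule_of :: "nat \<Rightarrow> (com list \<Rightarrow> nat) \<Rightarrow> com list \<Rightarrow> sym list \<Rightarrow> rule" where
  "rule_of k enc cs rd = (enc cs, rd,
     if cs = [] then (if rd ! 2 = S1 then 1 else 2, drop 2 rd, replicate (k + 2) MvS)
     else (case trans cs (rd ! 1) (rd ! 2) of (cs', b, m1, m2) \<Rightarrow>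
       (enc cs', b # drop 3 rd, MvS # m1 # m2 # replicate (k - 1) MvS)))"

lemma find_eq_Some:
  assumes "y \<in> set xs" "P y" "\<And>z. z \<in> set xs \<Longrightarrow> P z \<Longrightarrow> z = y"
  shows "find P xs = Some y"
proof -
  obtain z where z: "find P xs = Some z"
    using assms(1,2) find_None_iff[of P xs] by (cases "find P xs") auto
  then have "z \<in> set xs" "P z" by (auto simp: find_Some_iff)
  then show ?thesis using z assms(3) by simp
qed

text \<open>One rule for each element of \<open>conts P\<close> and each tuple of k + 2 read symbols
  suffices. Injective state numbers make the matching rule unique, so the order of the rules is
  immaterial.\<close>

lemma compile_to_tm:
  assumes "k \<ge> 1"
  obtains T where "wf_tm k T"
    "\<And>x i j w. exec x P (0, 0, \<lambda>_. Bl) (i, j, w) \<Longrightarrow> tm_run k T [] x = Some (w j = S1)"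
proof -
  note [simp del] = add_2_eq_Suc'
  obtain g :: "com list \<Rightarrow> nat" where g: "inj_on g (conts P)"
    using finite_imp_inj_to_nat_seg[OF finite_conts] by metis
  \<comment> \<open>The whole program becomes the initial state 0; the offset 3 keeps all other
    lists clear of the final states 1 and 2.\<close>
  define enc where "enc cs = (if cs = P then 0 else 3 + g cs)" for cs
  have enc_inj: "inj_on enc (conts P)"
    using g by (auto simp: enc_def inj_on_def)
  have enc_final: "enc cs \<noteq> 1" "enc cs \<noteq> 2" for cs by (auto simp: enc_def)
  obtain qs where qs: "set qs = conts P" using finite_list[OF finite_conts] by blast
  define rds where "rds = List.n_lists (k + 2) [S0, S1, Bl]"
  have rds: "rd \<in> set rds \<longleftrightarrow> length rd = k + 2" for rd
  proof -
    have "set rd \<subseteq> set [S0, S1, Bl]" using sym.exhaust by auto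
    then show ?thesis by (simp only: rds_def set_n_lists mem_Collect_eq simp_thms)
  qed
  define T where "T = concat (map (\<lambda>cs. map (rule_of k enc cs) rds) qs)"
  have T: "r \<in> set T \<longleftrightarrow> (\<exists>cs\<in>conts P. \<exists>rd. length rd = k + 2 \<and> r = rule_of k enc cs rd)" for r
  proof -
    have "set T = (\<Union>cs\<in>conts P. rule_of k enc cs ` set rds)" by (simp add: T_def qs)
    then show ?thesis using rds by blast
  qed
  have wf: "wf_tm k T"
    unfolding wf_tm_def
  proof
    fix r assume "r \<in> set T"
    then obtain cs rd where *: "length rd = k + 2" "r = rule_of k enc cs rd" using T by blast
    show "case r of (q, rd, q', wr, mvs) \<Rightarrow> length rd = k + 2 \<and> length wr = k \<and> length mvs = k + 2"
      using * assms by (auto simp: rule_of_def split: prod.split)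
  qed
  have find: "find (\<lambda>r. fst r = enc cs \<and> fst (snd r) = rd) T = Some (rule_of k enc cs rd)"
    if "cs \<in> conts P" "length rd = k + 2" for cs rd
  proof (rule find_eq_Some)
    show "rule_of k enc cs rd \<in> set T" using that T by blast
    show "z = rule_of k enc cs rd" if "z \<in> set T" "fst z = enc cs \<and> fst (snd z) = rd" for z
    proof -
      obtain cs' rd' where z: "cs' \<in> conts P" "z = rule_of k enc cs' rd'"
        using \<open>z \<in> set T\<close> T by blast
      then have "enc cs' = enc cs" "rd' = rd" using that(2) by (auto simp: rule_of_def)
      then show ?thesis using z inj_onD[OF enc_inj] \<open>cs \<in> conts P\<close> by metis
    qed
  qed (simp add: rule_of_def)
  have rd: "read_syms k [] x (embed k enc (cs, i, j, w)) =
      Bl # input_sym x i # w j # replicate (k - 1) Bl" for x cs i j w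
    using assms by (intro nth_equalityI)
      (auto simp: read_syms_def embed_def input_sym_def nth_Cons' nth_append simp del: upt_Suc)
  have step: "tm_step k T [] x (embed k enc c) = embed k enc (mstep x c)"
    if "fst c \<in> conts P" "fst c \<noteq> []" for x c
  proof -
    obtain cs i j w where c: "c = (cs, i, j, w)" by (metis prod_cases4)
    obtain cs' b m1 m2 where tr: "trans cs (input_sym x i) (w j) = (cs', b, m1, m2)"
      by (metis prod_cases4)
    let ?rd = "Bl # input_sym x i # w j # replicate (k - 1) Bl"
    have f: "find (\<lambda>r. fst r = enc cs \<and> fst (snd r) = ?rd) T = Some (rule_of k enc cs ?rd)"
      using that assms c by (intro find) auto
    have r: "rule_of k enc cs ?rd =
        (enc cs, ?rd, enc cs', b # replicate (k - 1) Bl, MvS # m1 # m2 # replicate (k - 1) MvS)"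
      using that c tr by (simp add: rule_of_def)
    have z: "map2 (\<lambda>h m. h + delta m) (replicate (k - 1) 0) (replicate (k - 1) MvS) =
        replicate (k - 1) (0::int)"
      by (intro nth_equalityI) auto
    have ws: "map (\<lambda>l. ((w # replicate (k - 1) (\<lambda>_. Bl)) ! l)
          ((0 # i # j # replicate (k - 1) 0) ! (l + 2) := (b # replicate (k - 1) Bl) ! l)) [0..<k]
        = w(j := b) # replicate (k - 1) (\<lambda>_. Bl)"
      using assms by (intro nth_equalityI) (auto simp: nth_Cons' simp del: upt_Suc)
    show ?thesis
      unfolding c tm_step_def rd[unfolded embed_def]
      using f r z ws enc_final[of cs] tr
      by (simp add: embed_def mstep_def rd[unfolded embed_def, simplified])
  qed
  have final: "fst (tm_step k T [] x (embed k enc ([], i, j, w))) = (if w j = S1 then 1 else 2)"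
    for x i j w
    using find[OF Nil_in_conts, of "Bl # input_sym x i # w j # replicate (k - 1) Bl"]
      enc_final[of "[]"] assms
    by (simp add: tm_step_def rd[unfolded embed_def, simplified] embed_def rule_of_def)
  \<comment> \<open>The step counts t and t' may differ: \<open>mstep\<close> idles on the empty
    list, whereas the machine would go on to a final state.\<close>
  have run: "\<exists>t'. (tm_step k T [] x ^^ t') (embed k enc (P, 0, 0, \<lambda>_. Bl)) =
        embed k enc ((mstep x ^^ t) (P, 0, 0, \<lambda>_. Bl)) \<and>
      fst ((mstep x ^^ t) (P, 0, 0, \<lambda>_. Bl)) \<in> conts P" for x t
  proof (induction t)
    case 0
    show ?case using self_in_conts by (auto intro: exI[of _ 0])
  next
    case (Suc t)
    let ?c = "(mstep x ^^ t) (P, 0, 0, \<lambda>_. Bl)"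
    obtain t' where t': "(tm_step k T [] x ^^ t') (embed k enc (P, 0, 0, \<lambda>_. Bl)) = embed k enc ?c"
        and c: "fst ?c \<in> conts P" using Suc by blast
    show ?case
    proof (cases "fst ?c = []")
      case True
      then have "mstep x ?c = ?c" by (metis mstep_Nil prod.collapse)
      then show ?thesis using t' c by auto
    next
      case False
      have "fst (mstep x ?c) \<in> conts P"
        using trans_in_conts[OF c] by (auto simp: mstep_def split: prod.splits) (metis fst_conv)
      moreover have "(tm_step k T [] x ^^ Suc t') (embed k enc (P, 0, 0, \<lambda>_. Bl)) =
          embed k enc (mstep x ?c)"
        using step[OF c False] t' by simp
      ultimately show ?thesis by (intro exI[of _ "Suc t'"]) simp
    qed
  qed
  have "tm_run k T [] x = Some (w j = S1)" if ex: "exec x P (0, 0, \<lambda>_. Bl) (i, j, w)" for x i j w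
  proof -
    let ?s = "\<lambda>t. (tm_step k T [] x ^^ t) (tm_init k)"
    have init: "tm_init k = embed k enc (P, 0, 0, \<lambda>_. Bl)"
      using assms by (cases k) (simp_all add: tm_init_def embed_def enc_def add_2_eq_Suc')
    obtain t where "(mstep x ^^ t) (P, 0, 0, \<lambda>_. Bl) = ([], i, j, w)"
      using spec[OF ex[unfolded exec_def], of "[]"] by auto
    then obtain t' where "?s t' = embed k enc ([], i, j, w)"
      using run[where t=t and x=x] unfolding init by auto
    then have fin: "fst (?s (Suc t')) = (if w j = S1 then 1 else 2)" using final by simp
    \<comment> \<open>\<open>tm_run\<close> looks for state 1 at any time before it considers state
      2, so rejecting also requires that state 1 is never visited. This holds because final
      configurations are fixed points.\<close>
    have stay: "?s (a + b) = ?s a" if "fst (?s a) = 1 \<or> fst (?s a) = 2" for a b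
      using that by (induction b) (auto simp: tm_step_def split: prod.splits)
    have unique: "fst (?s a) = fst (?s b)"
      if "fst (?s a) = 1 \<or> fst (?s a) = 2" "fst (?s b) = 1 \<or> fst (?s b) = 2" for a b
      using stay[OF that(1), of "b - a"] stay[OF that(2), of "a - b"]
      by (cases "a \<le> b") auto
    show ?thesis
    proof (cases "w j = S1")
      case True
      then show ?thesis using fin unfolding tm_run_def by (auto simp del: funpow.simps)
    next
      case False
      then have 2: "fst (?s (Suc t')) = 2" using fin by simp
      then have "fst (?s a) \<noteq> 1" for a using unique[of a "Suc t'"] by auto
      then show ?thesis using 2 False unfolding tm_run_def by (auto simp del: funpow.simps)
    qed
  qed
  then show ?thesis using that wf by blast
qed


section \<open>Counters on the work tape\<close>

definition right :: "nat \<Rightarrow> com list" where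
  "right p = replicate p (Act (\<lambda>a b. (b, MvS, MvR)))"

definition left :: "nat \<Rightarrow> com list" where
  "left p = replicate p (Act (\<lambda>a b. (b, MvS, MvL)))"

definition put :: "sym \<Rightarrow> com list" where
  "put c = [Act (\<lambda>a b. (c, MvS, MvS))]"

lemma exec_right: "exec x (right p) (i, j, w) (i, j + int p, w)"
proof (induction p arbitrary: j)
  case 0
  show ?case by (simp add: right_def exec_Nil)
next
  case (Suc p)
  have "exec x [Act (\<lambda>a b. (b, MvS, MvR))] (i, j, w) (i, j + 1, w)"
    using exec_Act[of "\<lambda>a b. (b, MvS, MvR)" x i w j] by simp
  from exec_Cons[OF this Suc] show ?case by (simp add: right_def algebra_simps)
qed

lemma exec_left: "exec x (left p) (i, j, w) (i, j - int p, w)"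
proof (induction p arbitrary: j)
  case 0
  show ?case by (simp add: left_def exec_Nil)
next
  case (Suc p)
  have "exec x [Act (\<lambda>a b. (b, MvS, MvL))] (i, j, w) (i, j - 1, w)"
    using exec_Act[of "\<lambda>a b. (b, MvS, MvL)" x i w j] by simp
  from exec_Cons[OF this Suc] show ?case by (simp add: left_def algebra_simps)
qed

lemma exec_put: "exec x (put c) (i, j, w) (i, j, w(j := c))"
  unfolding put_def using exec_Act[of "\<lambda>a b. (c, MvS, MvS)" x i w j] by simp

text \<open>The marker makes the origin detectable from every nonnegative cell, so no block has to
  know how far the head has moved.\<close>

definition home :: "com list" where
  "home = While (\<lambda>a b. b \<noteq> S0) (left 1) # right 1"

lemma exec_home:
  assumes "w (-1) = S0" "\<And>p. w (int p) \<noteq> S0"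
  shows "exec x home (i, int p, w) (i, 0, w)"
proof -
  have "exec x [While (\<lambda>a b. b \<noteq> S0) (left 1)] (i, int p - 1, w) (i, - 1, w)" for p
  proof (induction p)
    case 0
    show ?case using assms(1) by (auto intro!: exec_While_stop)
  next
    case (Suc p)
    show ?case
    proof (rule exec_While_step[OF _ exec_left])
      show "exec x [While (\<lambda>a b. b \<noteq> S0) (left 1)] (i, int (Suc p) - 1 - int 1, w) (i, - 1, w)"
        using Suc by simp
    qed (use assms(2)[of p] in simp)
  qed
  from this[of "Suc p"] have "exec x [While (\<lambda>a b. b \<noteq> S0) (left 1)] (i, int p, w) (i, - 1, w)"
    by simp
  moreover have "exec x (right 1) (i, -1, w) (i, 0, w)"
    using exec_right[of x 1 i "-1" w] by simp
  ultimately show ?thesis unfolding home_def by (rule exec_Cons)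
qed

text \<open>Register a < m is stored in unary on the cells with index a modulo m; cell -1 holds the only S0
  and so marks the origin.\<close>

definition represents :: "nat \<Rightarrow> (nat \<Rightarrow> nat) \<Rightarrow> (int \<Rightarrow> sym) \<Rightarrow> bool" where
  "represents m r w \<longleftrightarrow> w (-1) = S0 \<and>
     (\<forall>p. w (int p) = (if p div m < r (p mod m) then S1 else Bl))"

text \<open>The work head starts and ends on cell 0, which makes blocks composable. The input x and
  the position i of its head are arbitrary, so the new register contents depend on the old ones
  only.\<close>

definition runs :: "nat \<Rightarrow> com list \<Rightarrow> (nat \<Rightarrow> nat) \<Rightarrow> (nat \<Rightarrow> nat) \<Rightarrow> bool" where
  "runs m cs r r' \<longleftrightarrow> (\<forall>x i w. represents m r w \<longrightarrow>
     (\<exists>w'. represents m r' w' \<and> exec x cs (i, 0, w) (i, 0, w')))"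

lemma runs_append: "runs m cs r r' \<Longrightarrow> runs m ds r' r'' \<Longrightarrow> runs m (cs @ ds) r r''"
  unfolding runs_def using exec_append by meson

lemma represents_track:
  assumes "represents m r w" "a < m"
  shows "w (int (j * m + a)) = (if j < r a then S1 else Bl)"
  using assms by (simp add: represents_def del: of_nat_add of_nat_mult)

lemma exec_home_represents:
  assumes "represents m r w"
  shows "exec x home (i, int p, w) (i, 0, w)"
  using assms by (intro exec_home) (auto simp: represents_def)

definition scan :: "nat \<Rightarrow> com list" where
  "scan m = [While (\<lambda>a b. b = S1) (right m)]"

lemma exec_scan:
  assumes "represents m r w" "a < m"
  shows "exec x (scan m) (i, int a, w) (i, int (r a * m + a), w)"
proof -
  have "exec x (scan m) (i, int (j * m + a), w) (i, int (r a * m + a), w)" if "j \<le> r a" for j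
    using that
  proof (induction j rule: inc_induct)
    case base
    show ?case unfolding scan_def
      using represents_track[OF assms, of "r a"] by (intro exec_While_stop) simp
  next
    case (step j)
    show ?case unfolding scan_def
    proof (rule exec_While_step[OF _ exec_right])
      show "w (int (j * m + a)) = S1"
        using represents_track[OF assms, of j] step by simp
      show "exec x [While (\<lambda>a b. b = S1) (right m)] (i, int (j * m + a) + int m, w)
          (i, int (r a * m + a), w)"
        using step.IH by (simp add: scan_def algebra_simps)
    qed
  qed
  from this[of 0] show ?thesis by simp
qed

lemma track_eq_iff:
  fixes m :: nat
  assumes "a < m"
  shows "p = j * m + a \<longleftrightarrow> p div m = j \<and> p mod m = a"
proof
  assume "p div m = j \<and> p mod m = a"
  then show "p = j * m + a" using div_mult_mod_eq[of p m] by simp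
qed (use assms in auto)

lemma represents_inc:
  assumes "represents m r w" "a < m"
  shows "represents m (r(a := Suc (r a))) (w(int (r a * m + a) := S1))"
  unfolding represents_def
proof (intro conjI allI)
  fix p
  show "(w(int (r a * m + a) := S1)) (int p) =
      (if p div m < (r(a := Suc (r a))) (p mod m) then S1 else Bl)"
    using assms(1) track_eq_iff[OF assms(2), of p "r a"]
    by (auto simp: represents_def less_Suc_eq simp del: of_nat_add of_nat_mult)
qed (use assms in \<open>auto simp: represents_def simp del: of_nat_add of_nat_mult\<close>)

lemma represents_dec:
  assumes "represents m r w" "a < m" "r a = Suc v"
  shows "represents m (r(a := v)) (w(int (v * m + a) := Bl))"
  unfolding represents_def
proof (intro conjI allI)
  fix p
  show "(w(int (v * m + a) := Bl)) (int p) =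
      (if p div m < (r(a := v)) (p mod m) then S1 else Bl)"
    using assms(1,3) track_eq_iff[OF assms(2), of p v]
    by (auto simp: represents_def less_Suc_eq simp del: of_nat_add of_nat_mult)
qed (use assms in \<open>auto simp: represents_def simp del: of_nat_add of_nat_mult\<close>)

definition inc :: "nat \<Rightarrow> nat \<Rightarrow> com list" where
  "inc m a = right a @ scan m @ put S1 @ home"

text \<open>\<open>scan\<close> stops one track cell behind the last mark, hence the step back by m.
  The branch protects a register of value 0, for which that step would lead to a negative cell,
  possibly the marker.\<close>

definition dec :: "nat \<Rightarrow> nat \<Rightarrow> com list" where
  "dec m a = right a @ Branch (\<lambda>a b. b = S1) (scan m @ left m @ put Bl) [] # home"

text \<open>Register a is positive iff its first cell, cell a, is marked. The head must stand there
  at every test, while the body expects it on cell 0; this explains \<open>home\<close> and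
  \<open>right a\<close> around the body.\<close>

definition loop_while :: "nat \<Rightarrow> nat \<Rightarrow> com list \<Rightarrow> com list" where
  "loop_while m a cs = right a @ While (\<lambda>a b. b = S1) (home @ cs @ right a) # home"

lemma runs_inc:
  assumes "a < m"
  shows "runs m (inc m a) r (r(a := Suc (r a)))"
  unfolding runs_def
proof (intro allI impI exI conjI)
  fix x i w assume rep: "represents m r w"
  show rep': "represents m (r(a := Suc (r a))) (w(int (r a * m + a) := S1))"
    using represents_inc[OF rep assms] .
  have "exec x (right a) (i, 0, w) (i, int a, w)"
    using exec_right[of x a i 0 w] by simp
  then show "exec x (inc m a) (i, 0, w) (i, 0, w(int (r a * m + a) := S1))"
    unfolding inc_def
    by (rule exec_append[OF _ exec_append[OF exec_scan[OF rep assms]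
        exec_append[OF exec_put exec_home_represents[OF rep']]]])
qed

lemma runs_dec:
  assumes "a < m"
  shows "runs m (dec m a) r (r(a := r a - 1))"
  unfolding runs_def
proof (intro allI impI)
  fix x i w assume rep: "represents m r w"
  have r: "exec x (right a) (i, 0, w) (i, int a, w)"
    using exec_right[of x a i 0 w] by simp
  have a: "w (int a) = (if 0 < r a then S1 else Bl)"
    using represents_track[OF rep assms, of 0] by simp
  show "\<exists>w'. represents m (r(a := r a - 1)) w' \<and> exec x (dec m a) (i, 0, w) (i, 0, w')"
  proof (cases "r a")
    case 0
    then have "exec x [Branch (\<lambda>a b. b = S1) (scan m @ left m @ put Bl) []] (i, int a, w) (i, int a, w)"
      using a by (intro exec_Branch) (simp add: exec_Nil)
    then have "exec x (dec m a) (i, 0, w) (i, 0, w)"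
      unfolding dec_def by (rule exec_append[OF r exec_Cons[OF _ exec_home_represents[OF rep]]])
    moreover have "r(a := r a - 1) = r" using 0 by auto
    ultimately show ?thesis using rep by auto
  next
    case (Suc v)
    have rep': "represents m (r(a := r a - 1)) (w(int (v * m + a) := Bl))"
      using represents_dec[OF rep assms Suc] Suc by simp
    have "exec x (left m) (i, int (r a * m + a), w) (i, int (v * m + a), w)"
      using exec_left[of x m i "int (r a * m + a)" w] Suc by (simp add: algebra_simps)
    then have "exec x (scan m @ left m @ put Bl) (i, int a, w)
        (i, int (v * m + a), w(int (v * m + a) := Bl))"
      by (rule exec_append[OF exec_scan[OF rep assms] exec_append[OF _ exec_put]])
    then have "exec x [Branch (\<lambda>a b. b = S1) (scan m @ left m @ put Bl) []] (i, int a, w)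
        (i, int (v * m + a), w(int (v * m + a) := Bl))"
      using a Suc by (intro exec_Branch) simp
    then have "exec x (dec m a) (i, 0, w) (i, 0, w(int (v * m + a) := Bl))"
      unfolding dec_def by (rule exec_append[OF r exec_Cons[OF _ exec_home_represents[OF rep']]])
    then show ?thesis using rep' by blast
  qed
qed

text \<open>The value of register a is both the index of the invariant and the termination measure:
  the body has to lower it by exactly one.\<close>

lemma runs_loop_while:
  assumes "a < m"
    and count: "\<And>k r. I k r \<Longrightarrow> r a = k"
    and body: "\<And>k r. I (Suc k) r \<Longrightarrow> \<exists>r'. runs m cs r r' \<and> I k r'"
    and "I k r"
  shows "\<exists>r'. runs m (loop_while m a cs) r r' \<and> I 0 r'"
proof -
  let ?W = "While (\<lambda>a b. b = S1) (home @ cs @ right a)"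
  \<comment> \<open>The final registers are chosen before the input and the tape, as
    \<open>runs\<close> demands.\<close>
  have "\<exists>r'. I 0 r' \<and> (\<forall>x i w. represents m r w \<longrightarrow>
      (\<exists>w'. represents m r' w' \<and> exec x [?W] (i, int a, w) (i, int a, w')))"
    using \<open>I k r\<close>
  proof (induction k arbitrary: r)
    case 0
    have "exec x [?W] (i, int a, w) (i, int a, w)" if "represents m r w" for x i w
      using represents_track[OF that \<open>a < m\<close>, of 0] count[OF 0] by (intro exec_While_stop) simp
    then show ?case using 0 by blast
  next
    case (Suc k)
    obtain r1 where r1: "runs m cs r r1" "I k r1" using body[OF Suc.prems] by blast
    obtain r' where "I 0 r'" and r': "\<And>x i w. represents m r1 w \<Longrightarrow>
        \<exists>w'. represents m r' w' \<and> exec x [?W] (i, int a, w) (i, int a, w')"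
      using Suc.IH[OF r1(2)] by blast
    have "\<exists>w'. represents m r' w' \<and> exec x [?W] (i, int a, w) (i, int a, w')"
      if rep: "represents m r w" for x i w
    proof -
      obtain w1 where w1: "represents m r1 w1" "exec x cs (i, 0, w) (i, 0, w1)"
        using r1(1) rep unfolding runs_def by blast
      have "exec x (right a) (i, 0, w1) (i, int a, w1)"
        using exec_right[of x a i 0 w1] by simp
      then have ex: "exec x (home @ cs @ right a) (i, int a, w) (i, int a, w1)"
        by (rule exec_append[OF exec_home_represents[OF rep] exec_append[OF w1(2)]])
      obtain w' where w': "represents m r' w'" "exec x [?W] (i, int a, w1) (i, int a, w')"
        using r'[OF w1(1)] by blast
      have "w (int a) = S1"
        using represents_track[OF rep \<open>a < m\<close>, of 0] count[OF Suc.prems] by simp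
      then have "exec x [?W] (i, int a, w) (i, int a, w')"
        by (rule exec_While_step[OF _ ex w'(2)])
      then show ?thesis using w'(1) by blast
    qed
    then show ?case using \<open>I 0 r'\<close> by blast
  qed
  then obtain r' where "I 0 r'" and r': "\<And>x i w. represents m r w \<Longrightarrow>
      \<exists>w'. represents m r' w' \<and> exec x [?W] (i, int a, w) (i, int a, w')"
    by blast
  have "runs m (loop_while m a cs) r r'"
    unfolding runs_def
  proof (intro allI impI)
    fix x i w assume "represents m r w"
    then obtain w' where w': "represents m r' w'" "exec x [?W] (i, int a, w) (i, int a, w')"
      using r' by blast
    have "exec x (right a) (i, 0, w) (i, int a, w)"
      using exec_right[of x a i 0 w] by simp
    then have "exec x (loop_while m a cs) (i, 0, w) (i, 0, w')"
      unfolding loop_while_def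
      by (rule exec_append[OF _ exec_Cons[OF w'(2) exec_home_represents[OF w'(1)]]])
    then show "\<exists>w'. represents m r' w' \<and> exec x (loop_while m a cs) (i, 0, w) (i, 0, w')"
      using w'(1) by blast
  qed
  then show ?thesis using \<open>I 0 r'\<close> by blast
qed

definition clear :: "nat \<Rightarrow> nat \<Rightarrow> com list" where
  "clear m a = loop_while m a (dec m a)"

lemma runs_clear:
  assumes "a < m"
  shows "runs m (clear m a) r (r(a := 0))"
proof -
  have "\<exists>r'. runs m (loop_while m a (dec m a)) r r' \<and> r' = r(a := 0)"
  proof (rule runs_loop_while[where I = "\<lambda>k r'. r' = r(a := k)"])
    show "\<exists>r''. runs m (dec m a) r' r'' \<and> r'' = r(a := k)" if "r' = r(a := Suc k)" for k r'
      using runs_dec[OF assms, of r'] that by simp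
  qed (use assms in auto)
  then show ?thesis by (simp add: clear_def)
qed

definition move_reg :: "nat \<Rightarrow> nat \<Rightarrow> nat \<Rightarrow> com list" where
  "move_reg m a b = clear m b @ loop_while m a (dec m a @ inc m b)"

lemma runs_move_reg:
  assumes "a < m" "b < m" "a \<noteq> b"
  shows "runs m (move_reg m a b) r (r(b := r a, a := 0))"
proof -
  have "\<exists>r'. runs m (loop_while m a (dec m a @ inc m b)) (r(b := 0)) r' \<and>
      0 \<le> r a \<and> r' = r(b := r a - 0, a := 0)"
  proof (rule runs_loop_while[where I = "\<lambda>k r'. k \<le> r a \<and> r' = r(b := r a - k, a := k)" and k = "r a"])
    show "\<exists>r''. runs m (dec m a @ inc m b) r' r'' \<and> k \<le> r a \<and> r'' = r(b := r a - k, a := k)"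
      if "Suc k \<le> r a \<and> r' = r(b := r a - Suc k, a := Suc k)" for k r'
    proof -
      have "runs m (dec m a @ inc m b) r' (r(b := r a - k, a := k))"
        using runs_append[OF runs_dec[OF assms(1), of r'] runs_inc[OF assms(2)]] assms that
        by (simp add: fun_upd_twist Suc_diff_Suc)
      then show ?thesis using that by auto
    qed
  qed (use assms in auto)
  then show ?thesis
    unfolding move_reg_def using runs_append[OF runs_clear[OF assms(2), of r]] by auto
qed

text \<open>Reading a unary counter destroys it. A second copy in register \<open>Suc b\<close> is
  therefore made along the way, from which register a is restored.\<close>

definition copy_reg :: "nat \<Rightarrow> nat \<Rightarrow> nat \<Rightarrow> com list" where
  "copy_reg m a b = clear m b @ clear m (Suc b) @
     loop_while m a (dec m a @ inc m b @ inc m (Suc b)) @ move_reg m (Suc b) a"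

lemma runs_copy_reg:
  assumes "a < b" "Suc b < m"
  shows "runs m (copy_reg m a b) r (r(b := r a, Suc b := 0))"
proof -
  have "\<exists>r'. runs m (loop_while m a (dec m a @ inc m b @ inc m (Suc b))) (r(b := 0, Suc b := 0)) r'
      \<and> 0 \<le> r a \<and> r' = r(b := r a - 0, Suc b := r a - 0, a := 0)"
  proof (rule runs_loop_while[where I = "\<lambda>k r'. k \<le> r a \<and> r' = r(b := r a - k, Suc b := r a - k, a := k)"
        and k = "r a"])
    show "\<exists>r''. runs m (dec m a @ inc m b @ inc m (Suc b)) r' r'' \<and> k \<le> r a \<and>
        r'' = r(b := r a - k, Suc b := r a - k, a := k)"
      if "Suc k \<le> r a \<and> r' = r(b := r a - Suc k, Suc b := r a - Suc k, a := Suc k)" for k r'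
    proof -
      have "runs m (dec m a @ inc m b @ inc m (Suc b)) r' (r(b := r a - k, Suc b := r a - k, a := k))"
        using runs_append[OF runs_dec[of a m r'] runs_append[OF runs_inc[of b] runs_inc[of "Suc b"]]]
          assms that
        by (simp add: fun_upd_twist Suc_diff_Suc)
      then show ?thesis using that by auto
    qed
  qed (use assms in auto)
  then have 1: "runs m (loop_while m a (dec m a @ inc m b @ inc m (Suc b))) (r(b := 0, Suc b := 0))
      (r(b := r a, Suc b := r a, a := 0))" by auto
  have 2: "runs m (move_reg m (Suc b) a) (r(b := r a, Suc b := r a, a := 0)) (r(b := r a, Suc b := 0))"
    using runs_move_reg[of "Suc b" m a "r(b := r a, Suc b := r a, a := 0)"] assms
    by (simp add: fun_upd_twist)
  show ?thesis
    unfolding copy_reg_def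
    using runs_append[OF runs_clear runs_append[OF runs_clear runs_append[OF 1 2]]] assms by simp
qed


section \<open>Functions computed by bounded loops\<close>

text \<open>The registers work like a stack: those below s are protected, s receives the value, and
  those above s are scratch space with unspecified final contents.\<close>

definition evaluates :: "nat \<Rightarrow> com list \<Rightarrow> nat \<Rightarrow> ((nat \<Rightarrow> nat) \<Rightarrow> nat) \<Rightarrow> bool" where
  "evaluates m cs s f \<longleftrightarrow> (\<forall>r. \<exists>r'. runs m cs r r' \<and> (\<forall>i<s. r' i = r i) \<and> r' s = f r)"

lemma evaluatesE:
  assumes "evaluates m cs s f"
  obtains r' where "runs m cs r r'" "\<And>i. i < s \<Longrightarrow> r' i = r i" "r' s = f r"
  using assms unfolding evaluates_def by blast

text \<open>The result may be requested in any register s \<open>\<ge>\<close> d, so that computable functions of the first d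
  registers can be used at any nesting depth.\<close>

definition computable :: "nat \<Rightarrow> ((nat \<Rightarrow> nat) \<Rightarrow> nat) \<Rightarrow> bool" where
  "computable d f \<longleftrightarrow> (\<forall>r r'. (\<forall>i<d. r i = r' i) \<longrightarrow> f r = f r') \<and>
     (\<forall>s\<ge>d. \<exists>M. \<forall>m\<ge>M. \<exists>cs. evaluates m cs s f)"

lemma computable_cong: "computable d f \<Longrightarrow> (\<And>i. i < d \<Longrightarrow> r i = r' i) \<Longrightarrow> f r = f r'"
  by (simp add: computable_def)

lemma computable_mono: "computable d f \<Longrightarrow> d \<le> d' \<Longrightarrow> computable d' f"
  by (simp add: computable_def)

lemma computableE:
  assumes "computable d f" "d \<le> s"
  obtains M where "\<And>m. M \<le> m \<Longrightarrow> \<exists>cs. evaluates m cs s f"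
  using assms unfolding computable_def by blast

lemma computableI:
  assumes "\<And>r r'. (\<And>i. i < d \<Longrightarrow> r i = r' i) \<Longrightarrow> f r = f r'"
    and "\<And>s. d \<le> s \<Longrightarrow> \<exists>M. \<forall>m\<ge>M. \<exists>cs. evaluates m cs s f"
  shows "computable d f"
  using assms unfolding computable_def by blast

lemma computable_var:
  assumes "a < d"
  shows "computable d (\<lambda>r. r a)"
proof (rule computableI)
  fix s assume "d \<le> s"
  have "evaluates m (copy_reg m a s) s (\<lambda>r. r a)" if "s + 2 \<le> m" for m
    unfolding evaluates_def
  proof
    fix r
    show "\<exists>r'. runs m (copy_reg m a s) r r' \<and> (\<forall>i<s. r' i = r i) \<and> r' s = r a"
      using runs_copy_reg[of a s m r] assms \<open>d \<le> s\<close> that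
      by (intro exI[of _ "r(s := r a, Suc s := 0)"]) simp
  qed
  then show "\<exists>M. \<forall>m\<ge>M. \<exists>cs. evaluates m cs s (\<lambda>r. r a)" by blast
qed (use assms in simp)

lemma computable_zero: "computable d (\<lambda>r. 0)"
proof (rule computableI)
  fix s
  have "evaluates m (clear m s) s (\<lambda>r. 0)" if "Suc s \<le> m" for m
    unfolding evaluates_def
  proof
    fix r
    show "\<exists>r'. runs m (clear m s) r r' \<and> (\<forall>i<s. r' i = r i) \<and> r' s = 0"
      using runs_clear[of s m r] that by (intro exI[of _ "r(s := 0)"]) simp
  qed
  then show "\<exists>M. \<forall>m\<ge>M. \<exists>cs. evaluates m cs s (\<lambda>r. 0)" by blast
qed simp

lemma computable_update:
  assumes f: "computable d f"
    and op: "\<And>m s r. s < m \<Longrightarrow> runs m (op m s) r (r(s := F (r s)))"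
  shows "computable d (\<lambda>r. F (f r))"
proof (rule computableI)
  fix s assume "d \<le> s"
  then obtain M where M: "\<And>m. M \<le> m \<Longrightarrow> \<exists>cs. evaluates m cs s f"
    using computableE[OF f] by blast
  have "\<exists>cs. evaluates m cs s (\<lambda>r. F (f r))" if m: "M + Suc s \<le> m" for m
  proof -
    obtain cs where cs: "evaluates m cs s f" using M[of m] m by auto
    have "evaluates m (cs @ op m s) s (\<lambda>r. F (f r))"
      unfolding evaluates_def
    proof
      fix r
      obtain r' where r': "runs m cs r r'" "\<And>i. i < s \<Longrightarrow> r' i = r i" "r' s = f r"
        using evaluatesE[OF cs] by blast
      have "runs m (cs @ op m s) r (r'(s := F (r' s)))"
        using m by (intro runs_append[OF r'(1) op]) simp
      then show "\<exists>r'. runs m (cs @ op m s) r r' \<and> (\<forall>i<s. r' i = r i) \<and> r' s = F (f r)"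
        using r' by (intro exI[of _ "r'(s := F (r' s))"]) simp
    qed
    then show ?thesis by blast
  qed
  then show "\<exists>M. \<forall>m\<ge>M. \<exists>cs. evaluates m cs s (\<lambda>r. F (f r))" by blast
next
  fix r r' :: "nat \<Rightarrow> nat" assume "\<And>i. i < d \<Longrightarrow> r i = r' i"
  then show "F (f r) = F (f r')" using computable_cong[OF f, of r r'] by simp
qed

lemma computable_Suc: "computable d f \<Longrightarrow> computable d (\<lambda>r. Suc (f r))"
  using computable_update[of d f inc Suc] runs_inc by blast

lemma computable_pred: "computable d f \<Longrightarrow> computable d (\<lambda>r. f r - 1)"
  using computable_update[of d f dec "\<lambda>v. v - 1"] runs_dec by blast

text \<open>The loop body sees the number of remaining iterations, so its index runs downwards from k - 1
  to 0.\<close>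

primrec iter :: "(nat \<Rightarrow> nat \<Rightarrow> nat) \<Rightarrow> nat \<Rightarrow> nat \<Rightarrow> nat" where
  "iter \<phi> 0 v = v"
| "iter \<phi> (Suc k) v = iter \<phi> k (\<phi> k v)"

text \<open>Register s is the accumulator, s + 1 the loop counter, and the body delivers its result
  in s + 2. The body \<open>\<phi> r\<close> may use the first d registers as parameters; by
  \<open>cong\<close> nothing else in r influences it, so it stays the same function while the loop
  changes the other registers.\<close>

lemma computable_iter:
  assumes g: "computable d g" and f: "computable d f"
    and h: "\<And>s. d \<le> s \<Longrightarrow> computable (Suc (Suc s)) (\<lambda>r. \<phi> r (r (Suc s)) (r s))"
    and cong: "\<And>r r'. (\<And>i. i < d \<Longrightarrow> r i = r' i) \<Longrightarrow> \<phi> r = \<phi> r'"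
  shows "computable d (\<lambda>r. iter (\<phi> r) (g r) (f r))"
proof (rule computableI)
  fix s assume s: "d \<le> s"
  obtain M1 where M1: "\<And>m. M1 \<le> m \<Longrightarrow> \<exists>cs. evaluates m cs s f"
    using computableE[OF f s] by blast
  obtain M2 where M2: "\<And>m. M2 \<le> m \<Longrightarrow> \<exists>cs. evaluates m cs (Suc s) g"
    using computableE[OF g le_SucI[OF s]] by blast
  obtain M3 where M3: "\<And>m. M3 \<le> m \<Longrightarrow>
      \<exists>cs. evaluates m cs (Suc (Suc s)) (\<lambda>r. \<phi> r (r (Suc s)) (r s))"
    using computableE[OF h[OF s] order_refl] by blast
  have "\<exists>cs. evaluates m cs s (\<lambda>r. iter (\<phi> r) (g r) (f r))"
    if m: "M1 + M2 + M3 + s + 3 \<le> m" for m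
  proof -
    obtain cf where cf: "evaluates m cf s f" using M1[of m] m by auto
    obtain cg where cg: "evaluates m cg (Suc s) g" using M2[of m] m by auto
    obtain ch where ch: "evaluates m ch (Suc (Suc s)) (\<lambda>r. \<phi> r (r (Suc s)) (r s))"
      using M3[of m] m by auto
    \<comment> \<open>The counter is lowered before the body is evaluated, so that it shows k and
      not \<open>Suc k\<close>, in agreement with \<open>iter\<close>.\<close>
    let ?body = "dec m (Suc s) @ ch @ move_reg m (Suc (Suc s)) s"
    have "evaluates m (cf @ cg @ loop_while m (Suc s) ?body) s (\<lambda>r. iter (\<phi> r) (g r) (f r))"
      unfolding evaluates_def
    proof
      fix r0
      obtain r1 where r1: "runs m cf r0 r1" "\<And>i. i < s \<Longrightarrow> r1 i = r0 i" "r1 s = f r0"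
        using evaluatesE[OF cf] by blast
      obtain r2 where r2: "runs m cg r1 r2" "\<And>i. i < Suc s \<Longrightarrow> r2 i = r1 i" "r2 (Suc s) = g r1"
        using evaluatesE[OF cg] by blast
      have "g r1 = g r0" using r1(2) s by (intro computable_cong[OF g]) simp
      let ?I = "\<lambda>k r. r (Suc s) = k \<and> (\<forall>i<s. r i = r0 i) \<and>
        iter (\<phi> r0) k (r s) = iter (\<phi> r0) (g r0) (f r0)"
      have "\<exists>r'. runs m (loop_while m (Suc s) ?body) r2 r' \<and> ?I 0 r'"
      proof (rule runs_loop_while[where I = ?I and k = "g r0"])
        fix k r assume I: "?I (Suc k) r"
        let ?r = "r(Suc s := k)"
        have d: "runs m (dec m (Suc s)) r ?r"
          using runs_dec[of "Suc s" m r] m I by simp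
        obtain r' where r': "runs m ch ?r r'" "\<And>i. i < Suc (Suc s) \<Longrightarrow> r' i = ?r i"
            "r' (Suc (Suc s)) = \<phi> ?r (?r (Suc s)) (?r s)"
          using evaluatesE[OF ch] by blast
        have eq: "\<phi> ?r = \<phi> r0" using I s by (intro cong) simp
        let ?r' = "r'(s := r' (Suc (Suc s)), Suc (Suc s) := 0)"
        have "runs m ?body r ?r'"
          using m by (intro runs_append[OF d] runs_append[OF r'(1)] runs_move_reg) auto
        moreover have "?I k ?r'" using I r' eq by simp
        ultimately show "\<exists>r'. runs m ?body r r' \<and> ?I k r'" by blast
      qed (use m r1 r2 \<open>g r1 = g r0\<close> in auto)
      then obtain r3 where r3: "runs m (loop_while m (Suc s) ?body) r2 r3" "?I 0 r3" by blast
      show "\<exists>r'. runs m (cf @ cg @ loop_while m (Suc s) ?body) r0 r' \<and> (\<forall>i<s. r' i = r0 i) \<and>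
          r' s = iter (\<phi> r0) (g r0) (f r0)"
        using runs_append[OF r1(1) runs_append[OF r2(1) r3(1)]] r3(2) by auto
    qed
    then show ?thesis by blast
  qed
  then show "\<exists>M. \<forall>m\<ge>M. \<exists>cs. evaluates m cs s (\<lambda>r. iter (\<phi> r) (g r) (f r))" by blast
next
  fix r r' :: "nat \<Rightarrow> nat" assume "\<And>i. i < d \<Longrightarrow> r i = r' i"
  then show "iter (\<phi> r) (g r) (f r) = iter (\<phi> r') (g r') (f r')"
    using computable_cong[OF f, of r r'] computable_cong[OF g, of r r'] cong[of r r'] by simp
qed

lemma computable_add:
  assumes f: "computable d f" and g: "computable d g"
  shows "computable d (\<lambda>r. f r + g r)"
proof -
  have "iter (\<lambda>k v. Suc v) b a = a + b" for a b by (induction b arbitrary: a) auto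
  moreover have "computable d (\<lambda>r. iter (\<lambda>k v. Suc v) (g r) (f r))"
    by (intro computable_iter[where \<phi> = "\<lambda>r k v. Suc v"] f g computable_Suc computable_var) auto
  ultimately show ?thesis by simp
qed

lemma computable_diff:
  assumes f: "computable d f" and g: "computable d g"
  shows "computable d (\<lambda>r. f r - g r)"
proof -
  have "iter (\<lambda>k v. v - 1) b a = a - b" for a b by (induction b arbitrary: a) auto
  moreover have "computable d (\<lambda>r. iter (\<lambda>k v. v - 1) (g r) (f r))"
    by (intro computable_iter[where \<phi> = "\<lambda>r k v. v - 1"] f g computable_pred computable_var) auto
  ultimately show ?thesis by simp
qed

lemma computable_mult:
  assumes f: "computable d f" and g: "computable d g"
  shows "computable d (\<lambda>r. f r * g r)"
proof -
  have "iter (\<lambda>k v. v + a) b c = c + a * b" for a b c by (induction b arbitrary: c) auto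
  moreover have "computable d (\<lambda>r. iter (\<lambda>k v. v + f r) (g r) 0)"
  proof (rule computable_iter[where \<phi> = "\<lambda>r. \<lambda>k v. v + f r"])
    show "(\<lambda>k v. v + f r) = (\<lambda>k v. v + f r')" if "\<And>i. i < d \<Longrightarrow> r i = r' i" for r r'
      using computable_cong[OF f that] by simp
  qed (intro g computable_add computable_zero computable_var computable_mono[OF f]; simp)+
  ultimately show ?thesis by simp
qed

lemma computable_const: "computable d (\<lambda>r. c)"
  by (induction c) (auto intro: computable_zero computable_Suc)

lemma computable_power:
  assumes f: "computable d f" and g: "computable d g"
  shows "computable d (\<lambda>r. f r ^ g r)"
proof -
  have "iter (\<lambda>k v. v * a) b c = c * a ^ b" for a b c by (induction b arbitrary: c) auto
  moreover have "computable d (\<lambda>r. iter (\<lambda>k v. v * f r) (g r) 1)"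
  proof (rule computable_iter[where \<phi> = "\<lambda>r. \<lambda>k v. v * f r"])
    show "(\<lambda>k v. v * f r) = (\<lambda>k v. v * f r')" if "\<And>i. i < d \<Longrightarrow> r i = r' i" for r r'
      using computable_cong[OF f that] by simp
  qed (intro g computable_mult computable_const computable_var computable_mono[OF f]; simp)+
  ultimately show ?thesis by simp
qed

text \<open>A loop whose body ignores its argument acts as a conditional: with no iteration the
  start value p survives, otherwise it is overwritten by q.\<close>

lemma computable_if_zero:
  assumes f: "computable d f" and p: "computable d p" and q: "computable d q"
  shows "computable d (\<lambda>r. if f r = 0 then p r else q r)"
proof -
  have "iter (\<lambda>k v. c) a b = (if a = 0 then b else c)" for a b c
    by (induction a arbitrary: b) auto
  moreover have "computable d (\<lambda>r. iter (\<lambda>k v. q r) (f r) (p r))"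
  proof (rule computable_iter[where \<phi> = "\<lambda>r. \<lambda>k v. q r"])
    show "(\<lambda>k v. q r) = (\<lambda>k v. q r')" if "\<And>i. i < d \<Longrightarrow> r i = r' i" for r r'
      using computable_cong[OF q that] by simp
  qed (intro f p computable_mono[OF q]; simp)+
  ultimately show ?thesis by simp
qed

lemma computable_if_le:
  assumes "computable d f" "computable d g" "computable d p" "computable d q"
  shows "computable d (\<lambda>r. if f r \<le> g r then p r else q r)"
  using computable_if_zero[OF computable_diff[OF assms(1,2)] assms(3,4)] by simp

lemma computable_if_eq:
  assumes "computable d f" "computable d g" "computable d p" "computable d q"
  shows "computable d (\<lambda>r. if f r = g r then p r else q r)"
proof -
  have "(a - b) + (b - a) = 0 \<longleftrightarrow> a = b" for a b :: nat by auto
  then show ?thesis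
    using computable_if_zero[OF computable_add[OF computable_diff[OF assms(1,2)]
          computable_diff[OF assms(2,1)]] assms(3,4)] by simp
qed

text \<open>The candidate quotient is raised as long as its successor still fits. Since a div b is
  at most a, a rounds are enough.\<close>

lemma computable_div:
  assumes f: "computable d f" and g: "computable d g" and pos: "\<And>r. 0 < g r"
  shows "computable d (\<lambda>r. f r div g r)"
proof -
  let ?step = "\<lambda>a b (k::nat) v. if Suc v * b \<le> a then Suc v else (v::nat)"
  have *: "iter (?step a b) k v = min (a div b) (v + k)" if "0 < b" "v \<le> a div b" for a b k v
    using that
  proof (induction k arbitrary: v)
    case (Suc k)
    have "Suc v * b \<le> a \<longleftrightarrow> Suc v \<le> a div b"
      using \<open>0 < b\<close> by (simp add: less_eq_div_iff_mult_less_eq del: mult_Suc)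
    then show ?case using Suc by auto
  qed auto
  have "iter (?step a b) a 0 = a div b" if "0 < b" for a b using *[of b 0 a a] that by simp
  moreover have "computable d (\<lambda>r. iter (?step (f r) (g r)) (f r) 0)"
  proof (rule computable_iter[where \<phi> = "\<lambda>r. ?step (f r) (g r)"])
    show "(?step (f r) (g r)) = (?step (f r') (g r'))" if "\<And>i. i < d \<Longrightarrow> r i = r' i" for r r'
      using computable_cong[OF f that] computable_cong[OF g that] by simp
  qed (intro f computable_zero computable_if_le computable_mult computable_Suc
      computable_var computable_mono[OF f] computable_mono[OF g]; simp)+
  ultimately show ?thesis using pos by simp
qed

lemma computable_mod:
  assumes f: "computable d f" and g: "computable d g" and pos: "\<And>r. 0 < g r"
  shows "computable d (\<lambda>r. f r mod g r)"
  using computable_diff[OF f computable_mult[OF computable_div[OF assms] g]]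
  by (simp add: minus_div_mult_eq_mod)

lemmas computable_intros = computable_add computable_diff computable_mult computable_power
  computable_div computable_mod computable_Suc computable_const computable_var

section \<open>From computable functions to machines that read their input\<close>

definition num :: "bool list \<Rightarrow> nat" where
  "num x = foldl (\<lambda>a b. 2 * a + of_bool b) 0 x"

lemma num_snoc: "num (x @ [b]) = 2 * num x + of_bool b"
  by (simp add: num_def)

text \<open>The value is built in register d first, because f may depend on the old content of a.
  Agreement is claimed below d only, which hides the scratch registers.\<close>

lemma assign_reg:
  assumes "computable d f" "a < d"
  obtains M where "\<And>m. M \<le> m \<Longrightarrow>
    \<exists>cs. \<forall>r. \<exists>r'. runs m cs r r' \<and> (\<forall>i<d. r' i = (r(a := f r)) i)"
proof -
  obtain M where M: "\<And>m. M \<le> m \<Longrightarrow> \<exists>cs. evaluates m cs d f"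
    using computableE[OF assms(1) order_refl] by blast
  have "\<exists>cs. \<forall>r. \<exists>r'. runs m cs r r' \<and> (\<forall>i<d. r' i = (r(a := f r)) i)" if m: "M + Suc d \<le> m" for m
  proof -
    obtain cs where cs: "evaluates m cs d f" using M[of m] m by auto
    have "\<exists>r'. runs m (cs @ move_reg m d a) r r' \<and> (\<forall>i<d. r' i = (r(a := f r)) i)" for r
    proof -
      obtain r' where r': "runs m cs r r'" "\<And>i. i < d \<Longrightarrow> r' i = r i" "r' d = f r"
        using evaluatesE[OF cs] by blast
      have "runs m (cs @ move_reg m d a) r (r'(a := r' d, d := 0))"
        using m assms(2) by (intro runs_append[OF r'(1) runs_move_reg]) auto
      then show ?thesis using r' by (intro exI[of _ "r'(a := r' d, d := 0)"]) auto
    qed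
    then show ?thesis by blast
  qed
  then show ?thesis by (rule that)
qed

text \<open>While the input is read up to its first blank, register 0 counts the symbols and
  register 1 accumulates their binary value by Horner's scheme. The machine thus learns the length
  by itself and works for all lengths.\<close>

lemma computable_by_tm:
  assumes "k \<ge> 1" and F: "computable 2 (\<lambda>r. F (r 0) (r 1))"
  obtains T where "wf_tm k T" "\<And>x. tm_run k T [] x = Some (0 < F (length x) (num x))"
proof -
  have dbl: "computable 2 (\<lambda>r. 2 * r 1 + c)" for c
    by (intro computable_intros) auto
  obtain M0 where M0: "\<And>m. M0 \<le> m \<Longrightarrow>
      \<exists>cs. \<forall>r. \<exists>r'. runs m cs r r' \<and> (\<forall>i<2. r' i = (r(1 := 2 * r 1 + 0)) i)"
    by (rule assign_reg[OF dbl[of 0], of 1]) auto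
  obtain M1 where M1: "\<And>m. M1 \<le> m \<Longrightarrow>
      \<exists>cs. \<forall>r. \<exists>r'. runs m cs r r' \<and> (\<forall>i<2. r' i = (r(1 := 2 * r 1 + 1)) i)"
    by (rule assign_reg[OF dbl[of 1], of 1]) auto
  obtain M2 where M2: "\<And>m. M2 \<le> m \<Longrightarrow> \<exists>cs. evaluates m cs 2 (\<lambda>r. F (r 0) (r 1))"
    using computableE[OF F order_refl] by blast
  \<comment> \<open>The number of tracks is fixed for the whole program, so it has to exceed the
    bounds of all three parts; the 3 provides registers 0, 1 and 2.\<close>
  define m where "m = M0 + M1 + M2 + 3"
  obtain c0 where c0: "\<And>r. \<exists>r'. runs m c0 r r' \<and> (\<forall>i<2. r' i = (r(1 := 2 * r 1 + 0)) i)"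
    using M0[of m] by (auto simp: m_def)
  obtain c1 where c1: "\<And>r. \<exists>r'. runs m c1 r r' \<and> (\<forall>i<2. r' i = (r(1 := 2 * r 1 + 1)) i)"
    using M1[of m] by (auto simp: m_def)
  obtain cF where cF: "evaluates m cF 2 (\<lambda>r. F (r 0) (r 1))"
    using M2[of m] by (auto simp: m_def)
  define next_input where "next_input = [Act (\<lambda>a b. (b, MvR, MvS))]"
  define body where "body = Branch (\<lambda>a b. a = S1) c1 c0 # inc m 0 @ next_input"
  define load where "load = [While (\<lambda>a b. a \<noteq> Bl) body]"
  \<comment> \<open>The opening plants the marker on cell -1. The final \<open>right 2\<close> stops
    on the first cell of register 2, which is marked iff the computed value is positive.\<close>
  define P where "P = left 1 @ put S0 @ right 1 @ load @ cF @ right 2"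
  have load: "\<exists>r' w'. represents m r' w' \<and> r' 0 = length x \<and> r' 1 = num x \<and>
      exec x load (int n, 0, w) (int (length x), 0, w')"
    if "n \<le> length x" "represents m r w" "r 0 = n" "r 1 = num (take n x)" for x n r w
    using that
  proof (induction n arbitrary: r w rule: inc_induct)
    case base
    then have "exec x load (int (length x), 0, w) (int (length x), 0, w)"
      unfolding load_def by (intro exec_While_stop) (simp add: input_sym_def)
    then show ?case using base by auto
  next
    case (step n)
    have sym: "input_sym x (int n) = (if x ! n then S1 else S0)"
      using step.hyps by (simp add: input_sym_def)
    have "\<exists>r'. runs m (if x ! n then c1 else c0) r r' \<and> r' 0 = n \<and> r' 1 = num (take (Suc n) x)"
      using c1[of r] c0[of r] step by (auto simp: take_Suc_conv_app_nth num_snoc numeral_2_eq_2)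
    then obtain r1 where r1: "runs m (if x ! n then c1 else c0) r r1" "r1 0 = n"
        "r1 1 = num (take (Suc n) x)" by blast
    obtain w1 where w1: "represents m r1 w1" "exec x (if x ! n then c1 else c0) (int n, 0, w) (int n, 0, w1)"
      using r1(1) step.prems(1) unfolding runs_def by blast
    have "0 < m" by (simp add: m_def)
    then obtain w2 where w2: "represents m (r1(0 := Suc (r1 0))) w2"
        "exec x (inc m 0) (int n, 0, w1) (int n, 0, w2)"
      using runs_inc[of 0 m r1] w1(1) unfolding runs_def by blast
    have "exec x [Branch (\<lambda>a b. a = S1) c1 c0] (int n, 0, w) (int n, 0, w1)"
      using w1(2) sym by (intro exec_Branch) (simp split: if_splits)
    moreover have "exec x next_input (int n, 0, w2) (int (Suc n), 0, w2)"
      using exec_Act[of "\<lambda>a b. (b, MvR, MvS)" x "int n" w2 0]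
      by (simp add: next_input_def add.commute)
    ultimately have body: "exec x body (int n, 0, w) (int (Suc n), 0, w2)"
      unfolding body_def using exec_Cons exec_append w2(2) by blast
    obtain r' w' where "represents m r' w'" "r' 0 = length x" "r' 1 = num x"
        and ex: "exec x load (int (Suc n), 0, w2) (int (length x), 0, w')"
      using step.IH[OF w2(1)] r1 by auto
    moreover have "exec x load (int n, 0, w) (int (length x), 0, w')"
      unfolding load_def by (rule exec_While_step[OF _ body ex[unfolded load_def]]) (simp add: sym)
    ultimately show ?case by blast
  qed
  have P: "\<exists>i w. exec x P (0, 0, \<lambda>_. Bl) (i, 2, w) \<and> (w 2 = S1 \<longleftrightarrow> 0 < F (length x) (num x))" for x
  proof -
    let ?w = "(\<lambda>_. Bl)(- 1 := S0)"
    have "represents m (\<lambda>_. 0) ?w" by (simp add: represents_def)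
    then obtain r w where w: "represents m r w" "r 0 = length x" "r 1 = num x"
        "exec x load (0, 0, ?w) (int (length x), 0, w)"
      using load[of 0 x "\<lambda>_. 0" ?w] by (auto simp: num_def)
    obtain r' where r': "runs m cF r r'" "r' 2 = F (length x) (num x)"
      using evaluatesE[OF cF] w(2,3) by metis
    then obtain w' where w': "represents m r' w'"
        "exec x cF (int (length x), 0, w) (int (length x), 0, w')"
      using w(1) unfolding runs_def by blast
    have "exec x (left 1) (0, 0, \<lambda>_. Bl) (0, -1, \<lambda>_. Bl)"
      using exec_left[of x 1 0 0] by simp
    moreover have "exec x (right 1) (0, -1, ?w) (0, 0, ?w)" using exec_right[of x 1 0 "-1"] by simp
    moreover have "exec x (right 2) (int (length x), 0, w') (int (length x), 2, w')"
      using exec_right[of x 2 _ 0] by simp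
    ultimately have "exec x P (0, 0, \<lambda>_. Bl) (int (length x), 2, w')"
      unfolding P_def by (intro exec_append[OF _ exec_append[OF exec_put exec_append[OF _
              exec_append[OF w(4) exec_append[OF w'(2)]]]]])
    moreover have "w' 2 = S1 \<longleftrightarrow> 0 < r' 2"
      using represents_track[OF w'(1), of 2 0] by (simp add: m_def)
    ultimately show ?thesis
      using r' by (intro exI[of _ "int (length x)"] exI[of _ w']) simp
  qed
  obtain T where T: "wf_tm k T"
      "\<And>x i j w. exec x P (0, 0, \<lambda>_. Bl) (i, j, w) \<Longrightarrow> tm_run k T [] x = Some (w j = S1)"
    using compile_to_tm[OF assms(1)] by metis
  have "tm_run k T [] x = Some (0 < F (length x) (num x))" for x
    using P[of x] T(2) by fastforce
  then show ?thesis using that T(1) by blast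
qed


section \<open>The hard function\<close>

text \<open>A memory is a number v; a NAND of its bits j and k is appended as the new lowest bit, so
  addresses count backwards from the most recent result. The digits of the code c in base 2^(n + 1)
  are the addresses, the most significant ones first. Leading zero digits only push junk bits.\<close>

definition push :: "nat \<Rightarrow> nat \<Rightarrow> nat \<Rightarrow> nat" where
  "push v j k = 2 * v + (1 - (v div 2 ^ j mod 2) * (v div 2 ^ k mod 2))"

lemma push_eq: "push v j k = 2 * v + of_bool (\<not> (bit v j \<and> bit v k))"
  by (simp add: push_def bit_iff_odd mod_2_eq_odd)

lemma bit_push_0: "bit (push v j k) 0 \<longleftrightarrow> \<not> (bit v j \<and> bit v k)"
  by (simp add: push_eq bit_0)

lemma bit_push_Suc: "bit (push v j k) (Suc t) \<longleftrightarrow> bit v t"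
  by (simp add: push_eq bit_Suc)

text \<open>The memory starts as the input y, and the number of pushes is always 2^n. The digits are
  taken in pairs, the lower one being the first address.\<close>

definition sim :: "nat \<Rightarrow> nat \<Rightarrow> nat \<Rightarrow> nat" where
  "sim n c y = iter (\<lambda>k v. push v (c div (2 ^ Suc n * 2 ^ Suc n) ^ k mod 2 ^ Suc n)
     (c div (2 ^ Suc n * 2 ^ Suc n) ^ k div 2 ^ Suc n mod 2 ^ Suc n)) (2 ^ n) y"

text \<open>The arguments run downwards, so the output on 0 is appended last and the output on y
  ends up as bit y.\<close>

definition table :: "nat \<Rightarrow> nat \<Rightarrow> nat" where
  "table n c = iter (\<lambda>y v. 2 * v + sim n c y mod 2) (2 ^ n) 0"

definition is_table :: "nat \<Rightarrow> nat \<Rightarrow> nat" where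
  "is_table n w = iter (\<lambda>c b. if table n c = w then 1 else b) (2 ^ (2 ^ n - 1)) 0"

definition hard :: "nat \<Rightarrow> nat" where
  "hard n = iter (\<lambda>k v. if is_table n v = 0 then v else Suc v) (2 ^ 2 ^ n) 0"

text \<open>The length test makes the function false on strings of other lengths, as
  \<open>H n\<close> requires.\<close>

definition hard_fun :: "nat \<Rightarrow> bool list \<Rightarrow> bool" where
  "hard_fun n x \<longleftrightarrow> length x = n \<and> bit (hard n) (num x)"

section \<open>Computability of the hard function\<close>

lemma computable_push:
  assumes "computable d f" "computable d g" "computable d h"
  shows "computable d (\<lambda>r. push (f r) (g r) (h r))"
  unfolding push_def by (intro computable_intros assms) auto

lemma computable_sim:
  assumes n: "computable d n" and c: "computable d c" and y: "computable d y"
  shows "computable d (\<lambda>r. sim (n r) (c r) (y r))"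
proof -
  let ?step = "\<lambda>n c k v. push v (c div (2 ^ Suc n * 2 ^ Suc n) ^ k mod 2 ^ Suc n)
     (c div (2 ^ Suc n * 2 ^ Suc n) ^ k div 2 ^ Suc n mod 2 ^ Suc n)"
  show ?thesis
    unfolding sim_def
  proof (rule computable_iter[where \<phi> = "\<lambda>r. ?step (n r) (c r)"])
    show "computable d (\<lambda>r. 2 ^ n r)" by (intro computable_intros n)
    show "computable (Suc (Suc s)) (\<lambda>r. ?step (n r) (c r) (r (Suc s)) (r s))" if "d \<le> s" for s
      by (intro computable_push computable_intros computable_mono[OF n] computable_mono[OF c])
        (use that in auto)
    show "?step (n r) (c r) = ?step (n r') (c r')" if "\<And>i. i < d \<Longrightarrow> r i = r' i" for r r'
      using computable_cong[OF n that] computable_cong[OF c that] by simp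
  qed (rule y)
qed

lemma computable_table:
  assumes n: "computable d n" and c: "computable d c"
  shows "computable d (\<lambda>r. table (n r) (c r))"
  unfolding table_def
proof (rule computable_iter[where \<phi> = "\<lambda>r y v. 2 * v + sim (n r) (c r) y mod 2"])
  show "computable d (\<lambda>r. 2 ^ n r)" by (intro computable_intros n)
  show "computable (Suc (Suc s)) (\<lambda>r. 2 * r s + sim (n r) (c r) (r (Suc s)) mod 2)" if "d \<le> s" for s
    by (intro computable_sim computable_intros computable_mono[OF n] computable_mono[OF c])
      (use that in auto)
  show "(\<lambda>y v. 2 * v + sim (n r) (c r) y mod 2) = (\<lambda>y v. 2 * v + sim (n r') (c r') y mod 2)"
    if "\<And>i. i < d \<Longrightarrow> r i = r' i" for r r'
    using computable_cong[OF n that] computable_cong[OF c that] by simp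
qed (rule computable_zero)

lemma computable_is_table:
  assumes n: "computable d n" and w: "computable d w"
  shows "computable d (\<lambda>r. is_table (n r) (w r))"
  unfolding is_table_def
proof (rule computable_iter[where \<phi> = "\<lambda>r c b. if table (n r) c = w r then 1 else b"])
  show "computable d (\<lambda>r. 2 ^ (2 ^ n r - 1))" by (intro computable_intros n)
  show "computable (Suc (Suc s)) (\<lambda>r. if table (n r) (r (Suc s)) = w r then 1 else r s)"
    if "d \<le> s" for s
    by (intro computable_if_eq computable_table computable_intros computable_mono[OF n]
        computable_mono[OF w]) (use that in auto)
  show "(\<lambda>c b. if table (n r) c = w r then 1 else b) =
      (\<lambda>c b. if table (n r') c = w r' then 1 else b)"
    if "\<And>i. i < d \<Longrightarrow> r i = r' i" for r r'
    using computable_cong[OF n that] computable_cong[OF w that] by simp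
qed (rule computable_zero)

lemma computable_hard:
  assumes n: "computable d n"
  shows "computable d (\<lambda>r. hard (n r))"
  unfolding hard_def
proof (rule computable_iter[where \<phi> = "\<lambda>r k v. if is_table (n r) v = 0 then v else Suc v"])
  show "computable d (\<lambda>r. 2 ^ 2 ^ n r)" by (intro computable_intros n)
  show "computable (Suc (Suc s)) (\<lambda>r. if is_table (n r) (r s) = 0 then r s else Suc (r s))"
    if "d \<le> s" for s
    by (intro computable_if_zero computable_is_table computable_intros computable_mono[OF n])
      (use that in auto)
  show "(\<lambda>k v. if is_table (n r) v = 0 then v else Suc v) =
      (\<lambda>k v. if is_table (n r') v = 0 then v else Suc v)"
    if "\<And>i. i < d \<Longrightarrow> r i = r' i" for r r'
    using computable_cong[OF n that] by simp
qed (rule computable_zero)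

text \<open>T is the same for every length, so its code is a program of constant size for all the
  functions \<open>hard_fun n\<close>.\<close>

lemma hard_fun_by_tm:
  assumes "k \<ge> 1"
  obtains T where "wf_tm k T" "\<And>x. tm_run k T [] x = Some (hard_fun (length x) x)"
proof -
  have "computable 2 (\<lambda>r. hard (r 0) div 2 ^ r 1 mod 2)"
    by (intro computable_intros computable_hard) auto
  then obtain T where T: "wf_tm k T"
      "\<And>x. tm_run k T [] x = Some (0 < hard (length x) div 2 ^ num x mod 2)"
    using computable_by_tm[OF assms, of "\<lambda>n y. hard n div 2 ^ y mod 2"] by metis
  have "tm_run k T [] x = Some (hard_fun (length x) x)" for x
    unfolding T(2) by (simp add: hard_fun_def bit_iff_odd mod_2_eq_odd)
  then show ?thesis using that T(1) by blast
qed

section \<open>Truth tables and the search for a missing one\<close>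

lemma bit_iter_bits:
  "bit (iter (\<lambda>y v. 2 * v + b y mod 2) k v) t \<longleftrightarrow> (if t < k then odd (b t) else bit v (t - k))"
proof (induction k arbitrary: v)
  case (Suc k)
  have digit: "2 * v + b k mod 2 = 2 * v + of_bool (odd (b k))" by (simp add: mod_2_eq_odd)
  consider "t < k" | "t = k" | "k < t" by linarith
  then show ?case
  proof cases
    case 2
    then show ?thesis using Suc[of "2 * v + b k mod 2"] by (simp add: digit bit_0)
  next
    case 3
    then have "t - k = Suc (t - Suc k)" by simp
    then show ?thesis using 3 Suc[of "2 * v + b k mod 2"] by (simp add: digit bit_Suc)
  qed (use Suc in simp)
qed simp

lemma bit_table: "bit (table n c) t \<longleftrightarrow> t < 2 ^ n \<and> odd (sim n c t)"
  unfolding table_def bit_iter_bits by simp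

lemma is_table_eq_0_iff: "is_table n w = 0 \<longleftrightarrow> w \<notin> table n ` {..<2 ^ (2 ^ n - 1)}"
proof -
  have "iter (\<lambda>c b. if P c then 1 else b) k b = 0 \<longleftrightarrow> b = 0 \<and> (\<forall>c<k. \<not> P c)"
    for P k and b :: nat
    by (induction k arbitrary: b) (auto simp: less_Suc_eq)
  from this[of "\<lambda>c. table n c = w" "2 ^ (2 ^ n - 1)" 0] show ?thesis
    unfolding is_table_def by (simp only:) auto
qed

text \<open>Until \<open>P\<close> holds, each round moves v one step towards w and cannot pass it;
  from then on the rounds change nothing.\<close>

lemma iter_search:
  assumes "v \<le> w" "w \<le> v + K" "P w"
  shows "P (iter (\<lambda>k v. if P v then v else Suc v) K v) \<and>
    iter (\<lambda>k v. if P v then v else Suc v) K v \<le> w"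
  using assms
proof (induction K arbitrary: v)
  case (Suc K)
  show ?case
  proof (cases "P v")
    case True
    have "iter (\<lambda>k v. if P v then v else Suc v) K v = v" for K
      using True by (induction K) auto
    then show ?thesis using True Suc.prems by simp
  next
    case False
    then have "v \<noteq> w" using Suc.prems by auto
    then show ?thesis using False Suc.prems Suc.IH[of "Suc v"] by simp
  qed
qed auto

text \<open>Pigeonhole: K = 2^(2^n - 1) codes yield at most K tables, but there are K + 1 numbers up
  to K. The missing number found this way is at most K, so the search ends in time and its result
  still is a truth table on n bits.\<close>

lemma hard_notin_tables: "hard n \<notin> table n ` {..<2 ^ (2 ^ n - 1)}"
  and hard_less: "hard n < 2 ^ 2 ^ n"
proof -
  let ?K = "2 ^ (2 ^ n - 1) :: nat"
  have "\<exists>w\<le>?K. w \<notin> table n ` {..<?K}"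
  proof (rule ccontr)
    assume "\<not> ?thesis"
    then have "{..?K} \<subseteq> table n ` {..<?K}" by auto
    then have "card {..?K} \<le> ?K"
      using card_image_le[of "{..<?K}" "table n"] card_mono[of "table n ` {..<?K}" "{..?K}"] by simp
    then show False by simp
  qed
  then obtain w where w: "w \<le> ?K" "is_table n w = 0" using is_table_eq_0_iff by blast
  have "?K < 2 ^ 2 ^ n" by (intro power_strict_increasing) auto
  then have "w < 2 ^ 2 ^ n" by (rule le_less_trans[OF w(1)])
  then have *: "is_table n (hard n) = 0 \<and> hard n \<le> w"
    using iter_search[of 0 w "2 ^ 2 ^ n" "\<lambda>v. is_table n v = 0"] w(2) unfolding hard_def by simp
  then show "hard n \<notin> table n ` {..<?K}" using is_table_eq_0_iff by blast
  show "hard n < 2 ^ 2 ^ n" using * \<open>w < 2 ^ 2 ^ n\<close> by simp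
qed

lemma num_surj:
  assumes "y < 2 ^ n"
  obtains x where "length x = n" "num x = y"
  using assms
proof (induction n arbitrary: y thesis)
  case 0
  then show ?case by (simp add: num_def)
next
  case (Suc n)
  have "y div 2 < 2 ^ n" using Suc.prems(2) by auto
  then obtain x where x: "length x = n" "num x = y div 2" using Suc.IH by blast
  show ?case
    by (rule Suc.prems(1)[of "x @ [odd y]"]) (simp_all add: x num_snoc odd_two_times_div_two_succ)
qed

lemma bit_num:
  assumes "1 \<le> j" "j \<le> length x"
  shows "bit (num x) (length x - j) = x ! (j - 1)"
  using assms
proof (induction x rule: rev_induct)
  case (snoc b x)
  show ?case
  proof (cases "j = length x + 1")
    case True
    then show ?thesis by (simp add: num_snoc bit_0)
  next
    case False
    then have "length (x @ [b]) - j = Suc (length x - j)" "j - 1 < length x" using snoc.prems by auto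
    then show ?thesis using snoc False by (simp add: num_snoc bit_Suc nth_append)
  qed
qed simp

section \<open>Numerical codes of NAND programs\<close>

definition run :: "(nat \<times> nat) list \<Rightarrow> nat \<Rightarrow> nat" where
  "run ops v = fold (\<lambda>(j, k) v. push v j k) ops v"

text \<open>The first operation is the most significant digit pair because \<open>iter\<close>
  starts with the largest index. Junk operations (0, 0) at the front are leading zeros and leave the
  code unchanged.\<close>

fun encode :: "nat \<Rightarrow> (nat \<times> nat) list \<Rightarrow> nat" where
  "encode B [] = 0"
| "encode B ((j, k) # ops) = (k * B + j) * (B * B) ^ length ops + encode B ops"

lemma encode_less:
  assumes "0 < B" "set ops \<subseteq> {..<B} \<times> {..<B}"
  shows "encode B ops < (B * B) ^ length ops"
  using assms(2)
proof (induction ops)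
  case (Cons p ops)
  obtain j k where p: "p = (j, k)" by (cases p)
  have "k * B + j < B * B"
  proof -
    have "k + 1 \<le> B" "j < B" using Cons.prems p by auto
    then have "k * B + j < (k + 1) * B" by simp
    also have "\<dots> \<le> B * B" using \<open>k + 1 \<le> B\<close> by (rule mult_le_mono1)
    finally show ?thesis .
  qed
  then have "(k * B + j + 1) * (B * B) ^ length ops \<le> (B * B) * (B * B) ^ length ops"
    by (intro mult_le_mono1) simp
  then show ?case using Cons p by (simp add: algebra_simps)
qed simp

lemma encode_replicate: "encode B (replicate z (0, 0) @ ops) = encode B ops"
  by (induction z) auto

text \<open>The code c stays fixed while the list of operations shrinks; q collects the digits of
  the operations already executed.\<close>

lemma iter_encode:
  assumes "0 < B" "set ops \<subseteq> {..<B} \<times> {..<B}" "c = q * (B * B) ^ length ops + encode B ops"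
  shows "iter (\<lambda>k v. push v (c div (B * B) ^ k mod B) (c div (B * B) ^ k div B mod B))
    (length ops) v = run ops v"
  using assms(2,3)
proof (induction ops arbitrary: q v)
  case (Cons p ops)
  obtain j k where p: "p = (j, k)" by (cases p)
  have jk: "j < B" "k < B" using Cons.prems p by auto
  let ?q = "q * (B * B) + (k * B + j)"
  have c: "c = ?q * (B * B) ^ length ops + encode B ops"
    using Cons.prems p by (simp add: algebra_simps)
  have "encode B ops < (B * B) ^ length ops" using encode_less assms(1) Cons.prems by simp
  then have "c div (B * B) ^ length ops = ?q" unfolding c using assms(1) by simp
  moreover have q: "?q = (q * B + k) * B + j" by (simp add: algebra_simps)
  have "?q mod B = j" "?q div B mod B = k" unfolding q using jk by simp_all
  ultimately have "iter (\<lambda>k v. push v (c div (B * B) ^ k mod B) (c div (B * B) ^ k div B mod B))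
      (length (p # ops)) v = iter (\<lambda>k v. push v (c div (B * B) ^ k mod B)
        (c div (B * B) ^ k div B mod B)) (length ops) (push v j k)"
    by simp
  also have "\<dots> = run ops (push v j k)" using Cons.prems c by (intro Cons.IH[of ?q]) auto
  finally show ?case by (simp add: run_def p)
qed (simp add: run_def)

section \<open>Circuits as NAND programs\<close>

definition gate_ok :: "nat \<Rightarrow> nat \<Rightarrow> gate \<Rightarrow> bool" where
  "gate_ok n i g = (case g of
      Inp j \<Rightarrow> 1 \<le> j \<and> j \<le> n
    | AndG a b \<Rightarrow> a < i \<and> b < i \<and> a \<noteq> b
    | OrG a b \<Rightarrow> a < i \<and> b < i \<and> a \<noteq> b
    | NotG a \<Rightarrow> a < i)"

abbreviation eval_gates :: "bool list \<Rightarrow> gate list \<Rightarrow> bool list \<Rightarrow> bool list" where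
  "eval_gates x C vs \<equiv> fold (\<lambda>g vs. vs @ [gate_val x vs g]) C vs"

lemma length_eval_gates: "length (eval_gates x C vs) = length vs + length C"
  by (induction C arbitrary: vs) auto

lemma wf_circuit_iff: "wf_circuit n C \<longleftrightarrow> C \<noteq> [] \<and> (\<forall>i<length C. gate_ok n i (C ! i)) \<and>
    (\<forall>i<length C - 1. \<exists>j<length C. i \<in> parents (C ! j))"
  by (simp add: wf_circuit_def gate_ok_def)

text \<open>Every vertex takes exactly three pushes, the last one being its value: vertex t is then found
  at distance 3 (i - 1 - t) before vertex i is processed. The offset z is the number of junk bits
  pushed before the first vertex.\<close>

fun gate_ops :: "nat \<Rightarrow> nat \<Rightarrow> nat \<Rightarrow> gate \<Rightarrow> (nat \<times> nat) list" where
  "gate_ops n z i (Inp j) =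
     [(3 * i + z + (n - j), 3 * i + z + (n - j)), (0, 0), (1, 1)]"
| "gate_ops n z i (AndG a b) = [(3 * (i - 1 - a), 3 * (i - 1 - b)), (0, 0), (1, 1)]"
| "gate_ops n z i (OrG a b) =
     [(3 * (i - 1 - a), 3 * (i - 1 - a)), (3 * (i - 1 - b) + 1, 3 * (i - 1 - b) + 1), (0, 1)]"
| "gate_ops n z i (NotG a) = [(0, 0), (0, 0), (3 * (i - 1 - a) + 2, 3 * (i - 1 - a) + 2)]"

fun circuit_ops :: "nat \<Rightarrow> nat \<Rightarrow> nat \<Rightarrow> gate list \<Rightarrow> (nat \<times> nat) list" where
  "circuit_ops n z i [] = []"
| "circuit_ops n z i (g # C) = gate_ops n z i g @ circuit_ops n z (Suc i) C"

lemma length_gate_ops: "length (gate_ops n z i g) = 3"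
  by (cases g) auto

lemma length_circuit_ops: "length (circuit_ops n z i C) = 3 * length C"
  by (induction C arbitrary: i) (auto simp: length_gate_ops)

text \<open>Addresses are distances from the newest bit, with three bits per vertex and z junk bits
  above the input. The difference n - j arises because \<open>num\<close> gives the first input the
  highest weight.\<close>

definition stores :: "nat \<Rightarrow> nat \<Rightarrow> bool list \<Rightarrow> bool list \<Rightarrow> nat \<Rightarrow> bool" where
  "stores n z x vs v \<longleftrightarrow> (\<forall>t<length vs. bit v (3 * (length vs - 1 - t)) = vs ! t) \<and>
     (\<forall>j. 1 \<le> j \<and> j \<le> n \<longrightarrow> bit v (3 * length vs + z + (n - j)) = x ! (j - 1))"

lemma bit_run: "bit (run ops v) (length ops + t) = bit v t"
proof (induction ops arbitrary: v t)
  case (Cons p ops)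
  obtain j k where p: "p = (j, k)" by (cases p)
  show ?case using Cons[of "push v j k" "Suc t"] p by (simp add: run_def bit_push_Suc)
qed (simp add: run_def)

text \<open>An input is negated twice, an AND is a negated NAND, an OR is the NAND of two negations,
  and a NOT comes after two junk pushes. The summands 1 and 2 in the addresses compensate for the
  pushes that the same gate has already made.\<close>

lemma bit_gate_ops:
  assumes "stores n z x vs v" "gate_ok n (length vs) g"
  shows "bit (run (gate_ops n z (length vs) g) v) 0 = gate_val x vs g"
  using assms
  by (cases g) (auto simp: stores_def gate_ok_def run_def bit_push_0 bit_push_Suc)

lemma stores_gate_ops:
  assumes "stores n z x vs v" "gate_ok n (length vs) g"
  shows "stores n z x (vs @ [gate_val x vs g]) (run (gate_ops n z (length vs) g) v)"
proof -
  let ?v = "run (gate_ops n z (length vs) g) v"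
  have old: "bit ?v (3 + t) = bit v t" for t
    using bit_run[of "gate_ops n z (length vs) g"] by (simp add: length_gate_ops)
  have "bit ?v (3 * (length vs - t)) = vs ! t" if "t < length vs" for t
  proof -
    have "3 * (length vs - t) = 3 + 3 * (length vs - 1 - t)" using that by simp
    then show ?thesis using old assms(1) that by (simp add: stores_def)
  qed
  moreover have "bit ?v (3 * Suc (length vs) + z + (n - j)) = x ! (j - 1)" if "1 \<le> j" "j \<le> n" for j
    using old[of "3 * length vs + z + (n - j)"] assms(1) that by (simp add: stores_def algebra_simps)
  ultimately show ?thesis
    using bit_gate_ops[OF assms] by (auto simp: stores_def nth_append less_Suc_eq)
qed

lemma stores_circuit_ops:
  assumes "stores n z x vs v" "\<And>p. p < length C \<Longrightarrow> gate_ok n (length vs + p) (C ! p)"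
  shows "stores n z x (eval_gates x C vs) (run (circuit_ops n z (length vs) C) v)"
  using assms
proof (induction C arbitrary: vs v)
  case (Cons g C)
  have g: "gate_ok n (length vs) g" using Cons.prems(2)[of 0] by simp
  have "stores n z x (eval_gates x C (vs @ [gate_val x vs g]))
      (run (circuit_ops n z (length (vs @ [gate_val x vs g])) C) (run (gate_ops n z (length vs) g) v))"
    by (rule Cons.IH[OF stores_gate_ops[OF Cons.prems(1) g]]) (use Cons.prems(2)[of "Suc _"] in simp)
  then show ?case by (simp add: run_def)
qed (simp add: run_def)

lemma gate_ops_bounded:
  assumes "gate_ok n i g" "3 * i + 3 + z + n \<le> B"
  shows "set (gate_ops n z i g) \<subseteq> {..<B} \<times> {..<B}"
  using assms by (cases g) (auto simp: gate_ok_def)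

lemma circuit_ops_bounded:
  assumes "\<And>p. p < length C \<Longrightarrow> gate_ok n (i + p) (C ! p)" "3 * (i + length C) + z + n \<le> B"
  shows "set (circuit_ops n z i C) \<subseteq> {..<B} \<times> {..<B}"
  using assms
proof (induction C arbitrary: i)
  case (Cons g C)
  have "set (gate_ops n z i g) \<subseteq> {..<B} \<times> {..<B}"
    using Cons.prems(1)[of 0] Cons.prems(2) by (intro gate_ops_bounded) auto
  moreover have "set (circuit_ops n z (Suc i) C) \<subseteq> {..<B} \<times> {..<B}"
    by (rule Cons.IH) (use Cons.prems(1)[of "Suc _"] Cons.prems(2) in auto)
  ultimately show ?case by simp
qed simp

text \<open>The factor 6 (n + 1) is 3 NANDs per vertex times 2 addresses of n + 1 bits, so the size
  bound says precisely that the code has at most 2^n - 1 bits.\<close>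

lemma small_circuit_in_tables:
  assumes C: "wf_circuit n C" and small: "6 * (n + 1) * length C < 2 ^ n"
  obtains c where "c < 2 ^ (2 ^ n - 1)"
    "\<And>x. length x = n \<Longrightarrow> odd (sim n c (num x)) = circ_eval C x"
proof -
  define B :: nat where "B = 2 ^ Suc n"
  \<comment> \<open>Padding in front of the program brings it to exactly 2^n operations, the number
    that \<open>sim\<close> executes.\<close>
  define z where "z = 2 ^ n - 3 * length C"
  have "3 * length C \<le> 6 * (n + 1) * length C" by (intro mult_le_mono1) simp
  then have "3 * length C \<le> 2 ^ n" using small by linarith
  then have z: "z + 3 * length C = 2 ^ n" by (simp add: z_def)
  have "0 < B" by (simp add: B_def)
  have ok: "gate_ok n p (C ! p)" if "p < length C" for p
    using C that by (simp add: wf_circuit_iff)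
  let ?ops = "circuit_ops n z 0 C"
  let ?all = "replicate z (0, 0) @ ?ops"
  define c where "c = encode B ?ops"
  \<comment> \<open>At most 2^n pushed bits lie above n input bits, and n is less than 2^n, so
    addresses of n + 1 bits suffice.\<close>
  have "3 * (0 + length C) + z + n = 2 ^ n + n" using z by simp
  also have "\<dots> \<le> 2 ^ n + 2 ^ n" by (intro add_left_mono less_imp_le less_exp)
  also have "\<dots> = B" by (simp add: B_def)
  finally have bounded: "set ?ops \<subseteq> {..<B} \<times> {..<B}"
    using ok by (intro circuit_ops_bounded) auto
  have "c < (B * B) ^ (3 * length C)"
    using encode_less[OF \<open>0 < B\<close> bounded] by (simp add: c_def length_circuit_ops)
  also have "\<dots> = 2 ^ (6 * (n + 1) * length C)"
    by (simp add: B_def algebra_simps flip: power_mult power_add power_mult_distrib power_Suc)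
  also have "\<dots> \<le> 2 ^ (2 ^ n - 1)" using small by (intro power_increasing) auto
  finally have "c < 2 ^ (2 ^ n - 1)" .
  moreover have "odd (sim n c (num x)) = circ_eval C x" if x: "length x = n" for x
  proof -
    have "set ?all \<subseteq> {..<B} \<times> {..<B}" using bounded \<open>0 < B\<close> by auto
    then have "sim n c (num x) = run ?all (num x)"
      unfolding sim_def B_def[symmetric] z[symmetric]
      using iter_encode[of B ?all c 0 "num x"] \<open>0 < B\<close>
      by (simp add: c_def encode_replicate length_circuit_ops)
    also have "\<dots> = run ?ops (run (replicate z (0, 0)) (num x))" by (simp add: run_def)
    finally have sim: "sim n c (num x) = run ?ops (run (replicate z (0, 0)) (num x))" .
    have "stores n z x [] (run (replicate z (0, 0)) (num x))"
      unfolding stores_def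
    proof (intro conjI allI impI)
      fix j assume "1 \<le> j \<and> j \<le> n"
      then show "bit (run (replicate z (0, 0)) (num x)) (3 * length [] + z + (n - j)) = x ! (j - 1)"
        using bit_num[of j x] x bit_run[of "replicate z (0, 0)" "num x" "n - j"] by simp
    qed simp
    from stores_circuit_ops[OF this, of C] ok
    have st: "stores n z x (circ_vals C x) (sim n c (num x))" by (simp add: circ_vals_def sim)
    have len: "length (circ_vals C x) = length C"
      using length_eval_gates[of x C "[]"] by (simp add: circ_vals_def)
    have "C \<noteq> []" using C by (simp add: wf_circuit_iff)
    then have "0 < length C" "circ_vals C x \<noteq> []" using len by auto
    then show ?thesis
      using st[unfolded stores_def len, THEN conjunct1, rule_format, of "length C - 1"] len
      by (auto simp: circ_eval_def last_conv_nth bit_0)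
  qed
  ultimately show ?thesis using that by blast
qed

text \<open>The code of a smaller circuit would have \<open>hard n\<close> as its table. Below 2^n
  the bits agree because every index is the value of an input string; from 2^n on both numbers have
  no bits, which is where \<open>hard_less\<close> enters.\<close>

lemma hard_fun_needs_large_circuit:
  assumes C: "wf_circuit n C" and f: "\<And>x. length x = n \<Longrightarrow> circ_eval C x = hard_fun n x"
  shows "2 ^ n \<le> 6 * (n + 1) * length C"
proof (rule ccontr)
  assume "\<not> ?thesis"
  then obtain c where c: "c < 2 ^ (2 ^ n - 1)"
      "\<And>x. length x = n \<Longrightarrow> odd (sim n c (num x)) = circ_eval C x"
    using small_circuit_in_tables[OF C] by (metis not_le)
  have "table n c = hard n"
  proof (rule bit_eqI)
    fix t
    show "bit (table n c) t = bit (hard n) t"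
    proof (cases "t < 2 ^ n")
      case True
      then obtain x where x: "length x = n" "num x = t" using num_surj by blast
      then show ?thesis using c(2)[of x] f[of x] True by (simp add: bit_table hard_fun_def)
    next
      case False
      then have "(2::nat) ^ 2 ^ n \<le> 2 ^ t" by (intro power_increasing) auto
      with hard_less have "hard n < 2 ^ t" by (rule less_le_trans)
      then have "\<not> bit (hard n) t" by (simp add: bit_iff_odd)
      then show ?thesis using False by (simp add: bit_table)
    qed
  qed
  moreover have "table n c \<in> table n ` {..<2 ^ (2 ^ n - 1)}" using c(1) by blast
  ultimately show False using hard_notin_tables[of n] by metis
qed


section \<open>Existence of circuits\<close>

text \<open>The index i is the number of vertices that precede the block C in a larger circuit.\<close>

definition gates_ok :: "nat \<Rightarrow> nat \<Rightarrow> gate list \<Rightarrow> bool" where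
  "gates_ok n i C \<longleftrightarrow> C \<noteq> [] \<and> (\<forall>p<length C. gate_ok n (i + p) (C ! p)) \<and>
     (\<forall>p<length C - 1. \<exists>g\<in>set C. i + p \<in> parents g)"

text \<open>The values vs of the preceding vertices are arbitrary: the block computes f wherever it
  is placed, so blocks can simply be concatenated.\<close>

definition circuit_for :: "nat \<Rightarrow> (bool list \<Rightarrow> bool) \<Rightarrow> nat \<Rightarrow> gate list \<Rightarrow> bool" where
  "circuit_for n f i C \<longleftrightarrow> gates_ok n i C \<and> (\<forall>x vs. length x = n \<longrightarrow> length vs = i \<longrightarrow>
     (\<exists>ws. eval_gates x C vs = vs @ ws \<and> length ws = length C \<and> last ws = f x))"

definition has_circuit :: "nat \<Rightarrow> (bool list \<Rightarrow> bool) \<Rightarrow> bool" where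
  "has_circuit n f \<longleftrightarrow> (\<forall>i. \<exists>C. circuit_for n f i C)"

lemma nth_last_append: "ws \<noteq> [] \<Longrightarrow> (vs @ ws @ us) ! (length vs + length ws - 1) = last ws"
  by (cases ws rule: rev_cases) (simp_all add: nth_append)

lemma has_circuit_input:
  assumes "j < n"
  shows "has_circuit n (\<lambda>x. x ! j)"
proof -
  have "circuit_for n (\<lambda>x. x ! j) i [Inp (Suc j)]" for i
    using assms by (auto simp: circuit_for_def gates_ok_def gate_ok_def)
  then show ?thesis unfolding has_circuit_def by blast
qed

lemma has_circuit_not:
  assumes "has_circuit n f"
  shows "has_circuit n (\<lambda>x. \<not> f x)"
  unfolding has_circuit_def
proof
  fix i
  obtain C where C: "circuit_for n f i C" using assms unfolding has_circuit_def by blast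
  let ?D = "C @ [NotG (i + length C - 1)]"
  have "C \<noteq> []" using C by (simp add: circuit_for_def gates_ok_def)
  have "gates_ok n i ?D"
    unfolding gates_ok_def
  proof (intro conjI allI impI)
    fix p assume "p < length ?D"
    then consider "p < length C" | "p = length C" by fastforce
    then show "gate_ok n (i + p) (?D ! p)"
    proof cases
      case 1
      then show ?thesis using C by (simp add: circuit_for_def gates_ok_def nth_append)
    next
      case 2
      then show ?thesis using \<open>C \<noteq> []\<close> by (cases C) (simp_all add: gate_ok_def)
    qed
  next
    fix p assume "p < length ?D - 1"
    then consider "p < length C - 1" | "p = length C - 1" by fastforce
    then show "\<exists>g\<in>set ?D. i + p \<in> parents g"
    proof cases
      case 1
      then show ?thesis using C by (auto simp: circuit_for_def gates_ok_def)
    next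
      case 2
      then have "i + p = i + length C - 1" using \<open>C \<noteq> []\<close> by (cases C) auto
      then show ?thesis by simp
    qed
  qed simp
  moreover have "\<exists>ws. eval_gates x ?D vs = vs @ ws \<and> length ws = length ?D \<and> last ws = (\<not> f x)"
    if x: "length x = n" and vs: "length vs = i" for x vs
  proof -
    obtain ws where ws: "eval_gates x C vs = vs @ ws" "length ws = length C" "last ws = f x"
      using C x vs unfolding circuit_for_def by blast
    have "ws \<noteq> []" using ws(2) \<open>C \<noteq> []\<close> by auto
    then have "(vs @ ws) ! (i + length C - 1) = f x"
      using nth_last_append[of ws vs "[]"] ws(2,3) vs by simp
    then show ?thesis using ws(1,2) by (intro exI[of _ "ws @ [\<not> f x]"]) simp
  qed
  ultimately show "\<exists>C. circuit_for n (\<lambda>x. \<not> f x) i C" unfolding circuit_for_def by blast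
qed

text \<open>The second block is built for the position behind the first, and the new gate joins
  their last vertices. No vertices are shared, so the two operands are distinct as the gate demands;
  the size does not matter here.\<close>

lemma has_circuit_binary:
  assumes f: "has_circuit n f" and g: "has_circuit n g"
    and G: "\<And>a b. parents (G a b) = {a, b}"
      "\<And>i a b. gate_ok n i (G a b) \<longleftrightarrow> a < i \<and> b < i \<and> a \<noteq> b"
      "\<And>x vs a b. gate_val x vs (G a b) = op (vs ! a) (vs ! b)"
  shows "has_circuit n (\<lambda>x. op (f x) (g x))"
  unfolding has_circuit_def
proof
  fix i
  obtain C where C: "circuit_for n f i C" using f unfolding has_circuit_def by blast
  obtain D where D: "circuit_for n g (i + length C) D" using g unfolding has_circuit_def by blast
  let ?a = "i + length C - 1" and ?b = "i + length C + length D - 1"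
  let ?E = "C @ D @ [G ?a ?b]"
  have ne: "C \<noteq> []" "D \<noteq> []" using C D by (auto simp: circuit_for_def gates_ok_def)
  then have ne': "0 < length C" "0 < length D" by auto
  have okC: "\<And>p. p < length C \<Longrightarrow> gate_ok n (i + p) (C ! p)"
    and usedC: "\<And>p. p < length C - 1 \<Longrightarrow> \<exists>g\<in>set C. i + p \<in> parents g"
    using C by (auto simp: circuit_for_def gates_ok_def)
  have okD: "\<And>p. p < length D \<Longrightarrow> gate_ok n (i + length C + p) (D ! p)"
    and usedD: "\<And>p. p < length D - 1 \<Longrightarrow> \<exists>g\<in>set D. i + length C + p \<in> parents g"
    using D by (auto simp: circuit_for_def gates_ok_def)
  have "gates_ok n i ?E"
    unfolding gates_ok_def
  proof (intro conjI allI impI)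
    fix p assume "p < length ?E"
    then consider "p < length C" | "length C \<le> p" "p - length C < length D"
      | "p = length C + length D" by fastforce
    then show "gate_ok n (i + p) (?E ! p)"
    proof cases
      case 1
      then show ?thesis using okC by (simp add: nth_append)
    next
      case 2
      then show ?thesis using okD[of "p - length C"] by (simp add: nth_append)
    next
      case 3
      have "?a < i + p \<and> ?b < i + p \<and> ?a \<noteq> ?b" using ne' 3 by arith
      then show ?thesis using 3 by (simp add: nth_append G(2))
    qed
  next
    fix p assume p: "p < length ?E - 1"
    consider "p < length C - 1" | "p = length C - 1" | "length C \<le> p" "p - length C < length D - 1"
      | "p = length C + length D - 1" using p ne' by fastforce
    then show "\<exists>g\<in>set ?E. i + p \<in> parents g"
    proof cases
      case 1
      then show ?thesis using usedC by fastforce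
    next
      case 2
      then have "i + p = ?a" using ne' by arith
      then show ?thesis by (simp add: G(1))
    next
      case 3
      then show ?thesis using usedD[of "p - length C"] by auto
    next
      case 4
      then have "i + p = ?b" using ne' by arith
      then show ?thesis by (simp add: G(1))
    qed
  qed simp
  moreover have "\<exists>ws. eval_gates x ?E vs = vs @ ws \<and> length ws = length ?E \<and> last ws = op (f x) (g x)"
    if x: "length x = n" and vs: "length vs = i" for x vs
  proof -
    obtain ws where ws: "eval_gates x C vs = vs @ ws" "length ws = length C" "last ws = f x"
      using C x vs unfolding circuit_for_def by blast
    have "length (vs @ ws) = i + length C" using ws vs by simp
    then obtain us where us: "eval_gates x D (vs @ ws) = (vs @ ws) @ us" "length us = length D"
        "last us = g x"
      using D x unfolding circuit_for_def by blast
    have "ws \<noteq> []" "us \<noteq> []" using ws(2) us(2) ne by auto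
    have "(vs @ ws @ us) ! ?a = f x"
      using nth_last_append[OF \<open>ws \<noteq> []\<close>, of vs us] ws(2,3) vs by simp
    moreover have "(vs @ ws @ us) ! ?b = g x"
      using nth_last_append[OF \<open>us \<noteq> []\<close>, of "vs @ ws" "[]"] ws(2) us(2,3) vs by (simp add: add.assoc)
    ultimately show ?thesis using ws(1,2) us(1,2)
      by (intro exI[of _ "ws @ us @ [op (f x) (g x)]"]) (simp add: G(3))
  qed
  ultimately show "\<exists>C. circuit_for n (\<lambda>x. op (f x) (g x)) i C" unfolding circuit_for_def by blast
qed

lemma has_circuit_and: "has_circuit n f \<Longrightarrow> has_circuit n g \<Longrightarrow> has_circuit n (\<lambda>x. f x \<and> g x)"
  by (rule has_circuit_binary[where G = AndG]) (auto simp: gate_ok_def)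

lemma has_circuit_or: "has_circuit n f \<Longrightarrow> has_circuit n g \<Longrightarrow> has_circuit n (\<lambda>x. f x \<or> g x)"
  by (rule has_circuit_binary[where G = OrG]) (auto simp: gate_ok_def)

lemma has_circuit_cong:
  assumes "has_circuit n f" "\<And>x. length x = n \<Longrightarrow> f x = g x"
  shows "has_circuit n g"
  using assms(1) by (simp add: has_circuit_def circuit_for_def assms(2))

text \<open>Shannon expansion, by induction on the number m of leading bits on which f depends.
  Positivity of n cannot be dropped: the first vertex of a circuit has to be an input.\<close>

lemma has_circuit:
  assumes "0 < n"
  shows "has_circuit n f"
proof -
  have "has_circuit n f"
    if "m \<le> n" "\<And>x y. length x = n \<Longrightarrow> length y = n \<Longrightarrow> take m x = take m y \<Longrightarrow> f x = f y" for m f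
    using that
  proof (induction m arbitrary: f)
    case 0
    define c where "c = f (replicate n False)"
    have f: "f x = c" if "length x = n" for x unfolding c_def by (rule 0(2)) (use that in auto)
    \<comment> \<open>There are no constant gates.\<close>
    have false: "has_circuit n (\<lambda>x. x ! 0 \<and> \<not> x ! 0)"
      by (intro has_circuit_and has_circuit_not has_circuit_input assms)
    show ?case
    proof (cases c)
      case True
      show ?thesis by (rule has_circuit_cong[OF has_circuit_not[OF false]]) (simp add: f True)
    next
      case False
      show ?thesis by (rule has_circuit_cong[OF false]) (simp add: f False)
    qed
  next
    case (Suc m)
    have m: "m < n" using Suc.prems(1) by simp
    have sub: "has_circuit n (\<lambda>x. f (x[m := b]))" for b
    proof (rule Suc.IH)
      fix x y :: "bool list" assume xy: "length x = n" "length y = n" "take m x = take m y"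
      have "take (Suc m) (x[m := b]) = take (Suc m) (y[m := b])"
        using xy m by (simp add: take_Suc_conv_app_nth)
      then show "f (x[m := b]) = f (y[m := b])" using xy by (intro Suc.prems(2)) auto
    qed (use m in simp)
    have "has_circuit n (\<lambda>x. (x ! m \<and> f (x[m := True])) \<or> (\<not> x ! m \<and> f (x[m := False])))"
      by (intro has_circuit_or has_circuit_and has_circuit_not has_circuit_input m sub)
    then show ?case
    proof (rule has_circuit_cong)
      fix x :: "bool list" assume "length x = n"
      show "((x ! m \<and> f (x[m := True])) \<or> (\<not> x ! m \<and> f (x[m := False]))) = f x"
        using list_update_id[of x m] by (cases "x ! m") auto
    qed
  qed
  from this[of n f] show ?thesis by simp
qed

lemma circ_size_finite:
  assumes "0 < n"
  shows "circ_size n f \<noteq> \<infinity>"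
proof -
  obtain C where C: "circuit_for n f 0 C"
    using has_circuit[OF assms] unfolding has_circuit_def by blast
  have "wf_circuit n C"
    unfolding wf_circuit_iff
  proof (intro conjI allI impI)
    fix i assume "i < length C - 1"
    then obtain g where "g \<in> set C" "i \<in> parents g"
      using C by (auto simp: circuit_for_def gates_ok_def)
    then show "\<exists>j<length C. i \<in> parents (C ! j)" by (metis in_set_conv_nth)
  qed (use C in \<open>auto simp: circuit_for_def gates_ok_def\<close>)
  moreover have "circ_eval C x = f x" if "length x = n" for x
    using C that unfolding circuit_for_def circ_eval_def circ_vals_def by force
  ultimately have "circ_size n f \<le> enat (L (length C) n)"
    unfolding circ_size_def by (intro INF_lower) simp
  then show ?thesis by (metis enat_ord_simps(5) enat.distinct(1))
qed

section \<open>The ratio\<close>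

lemma le_two_power_clog: "0 < s \<Longrightarrow> s \<le> 2 ^ clog s"
proof -
  assume "0 < s"
  have "real s = 2 powr log 2 (real s)" using \<open>0 < s\<close> by simp
  also have "\<dots> \<le> 2 powr real (clog s)" by (simp add: clog_def) linarith
  finally have "real s \<le> real (2 ^ clog s)" by (simp add: powr_realpow)
  then show ?thesis by linarith
qed

text \<open>The threshold 14 is 2 * 7, where q = 7 is the least number with 12 (q + 1) <= 2^q; the
  rest is n <= 2 (n div 2) + 1.\<close>

lemma linear_le_power: "14 \<le> n \<Longrightarrow> 6 * (n + 1) \<le> (2::nat) ^ (n div 2)"
proof -
  assume n: "14 \<le> n"
  have "12 * (q + 1) \<le> (2::nat) ^ q" if "7 \<le> q" for q
    using that by (induction q rule: dec_induct) auto
  from this[of "n div 2"] have "12 * (n div 2 + 1) \<le> (2::nat) ^ (n div 2)" using n by linarith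
  moreover have "6 * (n + 1) \<le> 12 * (n div 2 + 1)" by presburger
  ultimately show ?thesis by linarith
qed

text \<open>As 6 (n + 1) is at most 2^(n div 2), s is at least 2^(n div 2). Hence 2
  \<open>clog s\<close> is at least n - 1, and with the 3 label bits a vertex costs more than n
  bits.\<close>

lemma circuit_length_bound:
  assumes "14 \<le> n" "2 ^ n \<le> 6 * (n + 1) * s"
  shows "2 ^ n \<le> 6 * L s n"
proof -
  have "0 < s" using assms(2) by (cases s) auto
  have "(2::nat) ^ (n div 2) * 2 ^ (n div 2) \<le> 2 ^ n"
    unfolding power_add[symmetric] by (intro power_increasing) auto
  also have "\<dots> \<le> 2 ^ (n div 2) * s"
    using assms(2) mult_le_mono1[OF linear_le_power[OF assms(1)], of s] by linarith
  also have "\<dots> \<le> 2 ^ (n div 2) * 2 ^ clog s"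
    using le_two_power_clog[OF \<open>0 < s\<close>] by simp
  finally have "n div 2 \<le> clog s" by simp
  then have "n + 1 \<le> 3 + max (2 * clog s) (clog n)" by linarith
  then have "s * (n + 1) \<le> s * (3 + max (2 * clog s) (clog n))" by (rule mult_le_mono2)
  then have "s * (n + 1) \<le> L s n" by (simp add: L_def)
  then have "6 * (n + 1) * s \<le> 6 * L s n" by (simp add: algebra_simps)
  then show ?thesis using assms(2) by linarith
qed

lemma circ_size_hard_fun:
  assumes "14 \<le> n"
  shows "enat (2 ^ n) \<le> 6 * circ_size n (hard_fun n)"
proof -
  have n: "0 < n" using assms by simp
  obtain a where a: "circ_size n (hard_fun n) = enat a"
    using circ_size_finite[OF n, of "hard_fun n"] by auto
  \<comment> \<open>A strict upper bound on the infimum yields an actual circuit, and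
    \<open>< Suc a\<close> turns back into \<open>\<le> a\<close>.\<close>
  then have "circ_size n (hard_fun n) < enat (Suc a)" by simp
  then obtain C where C: "wf_circuit n C" "\<And>x. length x = n \<Longrightarrow> circ_eval C x = hard_fun n x"
      "L (length C) n \<le> a"
    unfolding circ_size_def INF_less_iff by auto
  have "2 ^ n \<le> 6 * L (length C) n"
    using circuit_length_bound[OF assms hard_fun_needs_large_circuit[OF C(1,2)]] .
  then show ?thesis using C(3) by (simp add: a numeral_eq_enat)
qed

section \<open>The universal interpreter under a prefix-free encoding\<close>

context
  fixes k :: nat and E :: "tm \<Rightarrow> bool list"
  assumes pf: "prefix_free_on E {T. wf_tm k T}"
begin

text \<open>Two codes that begin the same program are comparable as prefixes and hence belong to the
  same machine, so the definite description picks (T, u).\<close>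

lemma U_append:
  assumes "wf_tm k T"
  shows "U k E (E T @ u) x = tm_run k T u x"
proof -
  have "(THE Tu. wf_tm k (fst Tu) \<and> E T @ u = E (fst Tu) @ snd Tu) = (T, u)"
  proof (rule the_equality)
    fix Tu assume Tu: "wf_tm k (fst Tu) \<and> E T @ u = E (fst Tu) @ snd Tu"
    then have "prefix (E T) (E (fst Tu)) \<or> prefix (E (fst Tu)) (E T)"
      by (metis prefixI prefix_same_cases)
    then have "fst Tu = T"
      using pf[unfolded prefix_free_on_def, rule_format, of T "fst Tu"]
        pf[unfolded prefix_free_on_def, rule_format, of "fst Tu" T] assms Tu by auto
    then show "Tu = (T, u)" using Tu by (cases Tu) auto
  qed (use assms in simp)
  then show ?thesis using assms unfolding U_def by auto
qed

text \<open>An empty code would be a prefix of every other code, and there are at least two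
  well-formed machines.\<close>

lemma encoding_nonempty:
  assumes "wf_tm k T"
  shows "E T \<noteq> []"
proof
  assume empty: "E T = []"
  let ?r = "(0, replicate (k + 2) S0, 0, replicate k S0, replicate (k + 2) MvS) :: rule"
  have "wf_tm k []" "wf_tm k [?r]" by (auto simp: wf_tm_def)
  then obtain T' where "wf_tm k T'" "T' \<noteq> T" by (metis list.distinct(1))
  then show False using pf assms empty unfolding prefix_free_on_def by auto
qed

text \<open>Every program that yields an output begins with a nonempty code. This rules out a zero
  denominator, which would make the ratio infinite.\<close>

lemma size_wrt_U_pos: "1 \<le> size_wrt (U k E) n f"
  unfolding size_wrt_def
proof (rule INF_greatest)
  fix h assume "h \<in> {h. \<forall>x. length x = n \<longrightarrow> U k E h x = Some (f x)}"
  then have "U k E h (replicate n False) \<noteq> None" by auto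
  then obtain T u where "wf_tm k T" "h = E T @ u" unfolding U_def by (meson)
  then show "1 \<le> enat (length h)" using encoding_nonempty by (simp add: one_enat_def Suc_le_eq)
qed

end

lemma finite_H: "finite (H n)"
proof -
  have "finite {x :: bool list. length x = n}"
    using finite_lists_length_eq[of "UNIV :: bool set" n] by simp
  from finite_set_of_finite_funs[OF this, of "UNIV :: bool set" False] show ?thesis
    by (rule finite_subset[rotated]) (auto simp: H_def)
qed

lemma ereal_le_real_of_ereal: "ereal c \<le> s \<Longrightarrow> s < \<infinity> \<Longrightarrow> c \<le> real_of_ereal s"
  by (cases s) auto

theorem mainTheorem10:
  fixes k :: nat and E :: "tm \<Rightarrow> bool list"
  assumes "k \<ge> 1"
    and "prefix_free_on E {T. wf_tm k T}"
  shows "(\<lambda>n. real_of_ereal (SUP f \<in> H n.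
            ereal_of_enat (circ_size n f) / ereal_of_enat (size_wrt (U k E) n f)))
         \<in> \<Omega>(\<lambda>n. 2 ^ n)"
proof -
  obtain T where T: "wf_tm k T" "\<And>x. tm_run k T [] x = Some (hard_fun (length x) x)"
    using hard_fun_by_tm[OF assms(1)] by blast
  \<comment> \<open>The program \<open>E T\<close> with empty remainder bounds the denominator for
    every n.\<close>
  define e where "e = length (E T)"
  have "0 < e" using encoding_nonempty[OF assms(2) T(1)] by (simp add: e_def)
  let ?ratio = "\<lambda>n f. ereal_of_enat (circ_size n f) / ereal_of_enat (size_wrt (U k E) n f)"
  have bound: "2 ^ n / real (6 * e) \<le> real_of_ereal (SUP f\<in>H n. ?ratio n f)" if n: "14 \<le> n" for n
  proof -
    have finite_ratio: "?ratio n f < \<infinity>" for f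
    proof -
      obtain a where a: "circ_size n f = enat a" using circ_size_finite[of n f] n by auto
      \<comment> \<open>If no program computes f, the denominator is infinite and the ratio is
        0.\<close>
      show ?thesis
      proof (cases "size_wrt (U k E) n f")
        case (enat b)
        then have "0 < b" using size_wrt_U_pos[OF assms(2), of n f] by (simp add: one_enat_def)
        then show ?thesis using a enat by simp
      qed (simp add: a)
    qed
    have hard: "hard_fun n \<in> H n" by (auto simp: H_def hard_fun_def)
    have "size_wrt (U k E) n (hard_fun n) \<le> enat e"
      unfolding size_wrt_def e_def
      by (rule INF_lower) (use U_append[OF assms(2) T(1), of "[]"] T(2) in auto)
    then obtain b where b: "size_wrt (U k E) n (hard_fun n) = enat b" "b \<le> e"
      by (cases "size_wrt (U k E) n (hard_fun n)") auto
    have "0 < b" using size_wrt_U_pos[OF assms(2), of n "hard_fun n"] b by (simp add: one_enat_def)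
    obtain a where a: "circ_size n (hard_fun n) = enat a"
      using circ_size_finite[of n "hard_fun n"] n by auto
    have "2 ^ n \<le> 6 * a" using circ_size_hard_fun[OF n] by (simp add: a numeral_eq_enat)
    then have "real (2 ^ n) \<le> real (6 * a)" by (rule of_nat_mono)
    then have "2 ^ n \<le> 6 * real a" by simp
    then have "2 ^ n / real (6 * e) \<le> 6 * real a / real (6 * e)"
      by (intro divide_right_mono) auto
    also have "\<dots> = real a / real e" by simp
    also have "\<dots> \<le> real a / real b"
      using \<open>0 < b\<close> \<open>b \<le> e\<close> by (intro divide_left_mono) auto
    finally have "2 ^ n / real (6 * e) \<le> real a / real b" .
    then have "ereal (2 ^ n / real (6 * e)) \<le> ?ratio n (hard_fun n)"
      using \<open>0 < b\<close> by (simp add: a b)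
    also have "\<dots> \<le> (SUP f\<in>H n. ?ratio n f)" using hard by (rule SUP_upper)
    finally have lower: "ereal (2 ^ n / real (6 * e)) \<le> (SUP f\<in>H n. ?ratio n f)" .
    \<comment> \<open>Over the finite set \<open>H n\<close> the supremum is attained, so it is
      finite because each single ratio is.\<close>
    have "(SUP f\<in>H n. ?ratio n f) = Max (?ratio n ` H n)"
      using finite_H hard by (intro Max_Sup[symmetric]) auto
    also have "\<dots> \<in> ?ratio n ` H n" using finite_H hard by (intro Max_in) auto
    finally obtain f where "(SUP f\<in>H n. ?ratio n f) = ?ratio n f" by (rule imageE)
    then have "(SUP f\<in>H n. ?ratio n f) < \<infinity>" using finite_ratio[of f] by (simp only:)
    with lower show ?thesis by (rule ereal_le_real_of_ereal)
  qed
  show ?thesis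
  proof (rule landau_omega.bigI)
    show "0 < 1 / real (6 * e)" using \<open>0 < e\<close> by simp
    show "eventually (\<lambda>n. 1 / real (6 * e) * norm (2 ^ n :: real) \<le>
        norm (real_of_ereal (SUP f\<in>H n. ?ratio n f))) at_top"
      using eventually_ge_at_top[of 14]
    proof eventually_elim
      case (elim n)
      then show ?case using order_trans[OF bound[OF elim] abs_ge_self] by simp
    qed
  qed
qed

end
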